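(* Let $p,q$ be positive integers, let $a\in M_{p\times q}(\mathbb N)$ be a matrix such that $\sum_{i,j}a_{ij}$ is even, and put $k=\frac12\sum_{i,j}a_{ij}$. Then the integral $I(a)=\int_{O_n}\prod_{i=1}^p\prod_{j=1}^q u_{ij}^{a_{ij}}\,du$ has a series expansion in $n^{-1}$ of the form $$I(a)=n^{-k}\sum_{d=0}^\infty H_d(a)\,n^{-d},$$ valid for all sufficiently large $n$ (depending on $a$), where $H_d(a)$ is the signed count of all $a$-admissible paths in the Brauer space $D_k$ of total length $d$, i.e. the number of such paths of signature $+$ minus the number of such paths of signature $-$.
   Context: $\mathbb N=\{0,1,2,\ldots\}$. $O_n$ is the group of real orthogonal $n\times n$ matrices $u=(u_{ij})$, and $du$ is its normalized (probability) Haar measure; $n\ge p,q$. A pairing of $\{1,\ldots,2k\}$ is a partition of this set into $k$ blocks of size $2$. For pairings $\pi,\sigma$, $\mathrm{loops}(\pi,\sigma)$ is the number of loops obtained by superposing $\pi$ and $\sigma$, i.e. the number of connected components of the multigraph on $\{1,\ldots,2k\}$ whose edges are the blocks of $\pi$ together with the blocks of $\sigma$. The Brauer space $D_k$ is the set of pairings of $\{1,\ldots,2k\}$ with the distance $d(\pi,\sigma)=k-\mathrm{loops}(\pi,\sigma)$. For a multi-index $i=(i_1,\ldots,i_{2k})$ and a pairing $\pi$, $\delta_\pi(i)=1$ if $i_s=i_t$ for every block $\{s,t\}\in\pi$, and $\delta_\pi(i)=0$ otherwise. The multi-indices $a_l,a_r$ of length $2k$ are obtained as follows: reading the entries of $a$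 row by row, from left to right in each row, replace the entry $a_{ij}$ by $a_{ij}$ consecutive copies of $i$ (to get $a_l$), respectively by $a_{ij}$ consecutive copies of $j$ (to get $a_r$). A path in $D_k$ from $\pi$ to $\sigma$ is a sequence $[\pi=\tau_0\ne\tau_1\ne\cdots\ne\tau_r=\sigma]$ of elements of $D_k$ with $r\ge0$ and consecutive terms distinct (for $r=0$ the path is the single point $\pi=\sigma$). Its signature is $+$ if $r$ is even and $-$ if $r$ is odd. Its total length is $\sum_{i=1}^r d(\tau_{i-1},\tau_i)$. The path is called $a$-admissible if its endpoints satisfy $\delta_\pi(a_l)=1$ and $\delta_\sigma(a_r)=1$. *)

theory Defs
  imports "HOL-Probability.Probability_Measure" "Jordan_Normal_Form.Matrix"
begin

text \<open>All indices are 0-based: rows and columns as in \<open>real mat\<close>, and pairings live on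
  \<open>{..<2 * k}\<close> instead of $\{1,\ldots,2k\}$.\<close>

subsection \<open>The orthogonal group and its Haar measure\<close>

definition orthogonal_group :: "nat \<Rightarrow> real mat set" where
  "orthogonal_group n = {u \<in> carrier_mat n n. u * transpose_mat u = 1\<^sub>m n \<and> transpose_mat u * u = 1\<^sub>m n}"

text \<open>The type \<open>real mat\<close> carries no topology. The Borel sets of the orthogonal group are the
  preimages of the Borel sets of $\mathbb{R}^{n \times n}$ under the map sending a matrix to its
  family of entries.\<close>

definition orthogonal_borel :: "nat \<Rightarrow> real mat measure" where
  "orthogonal_borel n =
     vimage_algebra (orthogonal_group n)
       (\<lambda>u. \<lambda>(i, j) \<in> {..<n} \<times> {..<n}. u $$ (i, j))
       (Pi\<^sub>M ({..<n} \<times> {..<n}) (\<lambda>_. borel))"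

text \<open>Characterises the measure uniquely. Left translations preserve the Borel sets, and right
  invariance is automatic because the group is compact.\<close>

definition is_orthogonal_haar :: "nat \<Rightarrow> real mat measure \<Rightarrow> bool" where
  "is_orthogonal_haar n M \<longleftrightarrow>
     prob_space M \<and> space M = orthogonal_group n \<and> sets M = sets (orthogonal_borel n) \<and>
     (\<forall>g \<in> orthogonal_group n. \<forall>B \<in> sets M. emeasure M ((\<lambda>u. g * u) ` B) = emeasure M B)"

definition orthogonal_integral :: "real mat measure \<Rightarrow> nat mat \<Rightarrow> real" where
  "orthogonal_integral M a =
     (LINT u|M. (\<Prod>i<dim_row a. \<Prod>j<dim_col a. (u $$ (i, j)) ^ (a $$ (i, j))))"

subsection \<open>The Brauer space\<close>

definition pairings :: "nat \<Rightarrow> nat set set set" where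
  "pairings k = {\<pi>. partition_on {..<2 * k} \<pi> \<and> (\<forall>B \<in> \<pi>. card B = 2)}"

definition joined :: "nat set set \<Rightarrow> nat set set \<Rightarrow> (nat \<times> nat) set" where
  "joined \<pi> \<sigma> = {(s, t). \<exists>B \<in> \<pi> \<union> \<sigma>. s \<in> B \<and> t \<in> B}"

text \<open>Counts connected components, i.e. the classes of the reachability relation; edge
  multiplicities play no role.\<close>

definition loops :: "nat \<Rightarrow> nat set set \<Rightarrow> nat set set \<Rightarrow> nat" where
  "loops k \<pi> \<sigma> = card ({..<2 * k} // (joined \<pi> \<sigma>)\<^sup>*)"

text \<open>The subtraction does not truncate on \<open>pairings k\<close>: every component contains a block of
  \<open>\<pi>\<close>, so there are at most \<open>k\<close> of them.\<close>

definition brauer_dist :: "nat \<Rightarrow> nat set set \<Rightarrow> nat set set \<Rightarrow> nat" where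
  "brauer_dist k \<pi> \<sigma> = k - loops k \<pi> \<sigma>"

text \<open>The condition $\delta_\pi(i) = 1$.\<close>

definition pairing_delta :: "nat set set \<Rightarrow> nat list \<Rightarrow> bool" where
  "pairing_delta \<pi> is \<longleftrightarrow> (\<forall>B \<in> \<pi>. \<forall>s \<in> B. \<forall>t \<in> B. is ! s = is ! t)"

definition left_index :: "nat mat \<Rightarrow> nat list" where
  "left_index a =
     concat (map (\<lambda>i. concat (map (\<lambda>j. replicate (a $$ (i, j)) i) [0..<dim_col a])) [0..<dim_row a])"

definition right_index :: "nat mat \<Rightarrow> nat list" where
  "right_index a =
     concat (map (\<lambda>i. concat (map (\<lambda>j. replicate (a $$ (i, j)) j) [0..<dim_col a])) [0..<dim_row a])"

text \<open>A path $[\tau_0, \ldots, \tau_r]$ is the list of its $r + 1$ points.\<close>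

definition brauer_paths :: "nat \<Rightarrow> nat set set list set" where
  "brauer_paths k = {\<tau>. \<tau> \<noteq> [] \<and> set \<tau> \<subseteq> pairings k \<and> successively (\<noteq>) \<tau>}"

definition path_steps :: "nat set set list \<Rightarrow> nat" where
  "path_steps \<tau> = length \<tau> - 1"

definition path_length :: "nat \<Rightarrow> nat set set list \<Rightarrow> nat" where
  "path_length k \<tau> = (\<Sum>i<path_steps \<tau>. brauer_dist k (\<tau> ! i) (\<tau> ! Suc i))"

definition admissible_paths :: "nat \<Rightarrow> nat mat \<Rightarrow> nat \<Rightarrow> nat set set list set" where
  "admissible_paths k a d =
     {\<tau> \<in> brauer_paths k. pairing_delta (hd \<tau>) (left_index a) \<and>
        pairing_delta (last \<tau>) (right_index a) \<and> path_length k \<tau> = d}"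

text \<open>Each set counted is finite: distinct pairings have distance at least 1, so a path of total
  length \<open>d\<close> has at most \<open>d\<close> steps.\<close>

definition signed_count :: "nat \<Rightarrow> nat mat \<Rightarrow> nat \<Rightarrow> int" where
  "signed_count k a d =
     int (card {\<tau> \<in> admissible_paths k a d. even (path_steps \<tau>)}) -
     int (card {\<tau> \<in> admissible_paths k a d. odd (path_steps \<tau>)})"

end

theory Submission
  imports Defs "Jordan_Normal_Form.Determinant"
begin

text \<open>For a fixed right index \<open>j\<close>, left invariance of the Haar measure makes the moments
  $E(i) = \int \prod_s u_{i_s j_s}\,du$ an invariant tensor, and for $n \ge k$ every invariant tensor
  is a combination $\sum_\pi c_\pi \delta_\pi(i)$ over pairings: sign changes kill indices with a
  value of odd multiplicity, permutations make the value depend only on which entries of the index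
  agree, and infinitesimal rotations reduce multiplicities greater than two.
  Orthonormality of the columns gives $\sum_i \delta_\rho(i) E(i) = \delta_\rho(j)$, so the
  coefficients solve a linear system with the Gram matrix
  $n^{\mathrm{loops}(\rho,\pi)} = n^{k - d(\rho,\pi)}$.
  Splitting off the last step of a path shows that the generating functions of signed paths,
  evaluated at $1/n$, are the entries of the inverse of the matrix $n^{-d(\rho,\pi)}$; they
  converge as soon as $n$ exceeds the number of pairings.\<close>

section \<open>Pairings and loops\<close>

text \<open>The path count is a Neumann series. The matrix X with entries n^(-d(rho,sigma)) has
  diagonal 1, so X = 1 + Y with Y supported off the diagonal, and formally X^(-1) is the sum of the
  (-Y)^r. Expanding Y^r gives the paths with r steps, each weighted by n to minus its total length,
  and (-1)^r is the signature. Regrouping by total length instead of r produces the coefficients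
  H_d. Distinct pairings have distance at least 1, which makes the regrouped counts finite and
  bounds the signed count of paths of length d between two given pairings by |D_k|^d; hence the
  threshold n > |D_k|. Spanning supplies coefficients for the moment tensor, and a left inverse of
  the Gram matrix forces their values. The two indices enter differently: invariance acts on the row
  index, while orthonormality of columns evaluates the contractions in terms of the column
  index.\<close>

definition block_constant :: "'a set set \<Rightarrow> ('a \<Rightarrow> 'b) \<Rightarrow> bool" where
  "block_constant P l \<longleftrightarrow> (\<forall>B\<in>P. \<forall>s\<in>B. \<forall>t\<in>B. l s = l t)"

lemma block_constantD: "block_constant P l \<Longrightarrow> B \<in> P \<Longrightarrow> s \<in> B \<Longrightarrow> t \<in> B \<Longrightarrow> l s = l t"
  unfolding block_constant_def by blast

text \<open>A block constant function is a free choice of one value per block, so the sum over such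
  functions factorises over the blocks. Arbitrary partitions are allowed because the lemma is
  applied to pairings and to joins of two pairings, with \<open>f\<close> constantly 1 for counting
  or with vectors of an orthonormal family.\<close>

lemma sum_block_constant:
  fixes f :: "'a \<Rightarrow> 'b \<Rightarrow> real"
  assumes S: "finite S" and P: "partition_on S P" and N: "finite N"
  shows "(\<Sum>l\<in>S \<rightarrow>\<^sub>E N. of_bool (block_constant P l) * (\<Prod>s\<in>S. f s (l s))) =
    (\<Prod>B\<in>P. \<Sum>v\<in>N. \<Prod>s\<in>B. f s v)"
proof -
  have finP: "finite P"
    using S P by (metis finite_UnionD partition_onD1)
  have "\<forall>s\<in>S. \<exists>B. B \<in> P \<and> s \<in> B"
    using P by (auto simp: partition_on_def)
  then obtain blk where blk: "\<And>s. s \<in> S \<Longrightarrow> blk s \<in> P \<and> s \<in> blk s"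
    by metis
  have blk_eq: "blk s = B" if "B \<in> P" "s \<in> B" for s B
  proof -
    have "s \<in> S" using P that by (auto simp: partition_on_def)
    then show ?thesis using blk[of s] that partition_onD2[OF P] by (meson disjointD disjoint_iff)
  qed
  have "\<forall>B\<in>P. \<exists>s. s \<in> B"
    using partition_onD3[OF P] by (metis ex_in_conv)
  then obtain rep where rep: "\<And>B. B \<in> P \<Longrightarrow> rep B \<in> B"
    by metis
  have sub: "s \<in> S" if "B \<in> P" "s \<in> B" for s B
    using P that by (auto simp: partition_on_def)
  have "(\<Sum>l\<in>S \<rightarrow>\<^sub>E N. of_bool (block_constant P l) * (\<Prod>s\<in>S. f s (l s))) =
      (\<Sum>l\<in>{l \<in> S \<rightarrow>\<^sub>E N. block_constant P l}. \<Prod>s\<in>S. f s (l s))"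
    using S N by (intro sum.mono_neutral_cong_right) (auto simp: finite_PiE)
  also have "\<dots> = (\<Sum>h\<in>P \<rightarrow>\<^sub>E N. \<Prod>B\<in>P. \<Prod>s\<in>B. f s (h B))"
  \<comment> \<open>A function on blocks is read off at the representatives \<open>rep B\<close>,
    and pulled back to points along \<open>blk\<close>.\<close>
  proof (rule sum.reindex_bij_witness[where j = "\<lambda>l. \<lambda>B\<in>P. l (rep B)" and
        i = "\<lambda>h. \<lambda>s\<in>S. h (blk s)"])
    fix l assume "l \<in> {l \<in> S \<rightarrow>\<^sub>E N. block_constant P l}"
    then have l: "l \<in> S \<rightarrow>\<^sub>E N" and bc: "block_constant P l" by auto
    show "(\<lambda>s\<in>S. (\<lambda>B\<in>P. l (rep B)) (blk s)) = l"
    proof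
      fix s
      show "(\<lambda>s\<in>S. (\<lambda>B\<in>P. l (rep B)) (blk s)) s = l s"
      proof (cases "s \<in> S")
        case True
        then show ?thesis using blk[OF True] rep block_constantD[OF bc, of "blk s"] by simp
      qed (use l in \<open>simp add: PiE_def extensional_def\<close>)
    qed
    show "(\<lambda>B\<in>P. l (rep B)) \<in> P \<rightarrow>\<^sub>E N"
      using l rep sub by auto
    have "(\<Prod>s\<in>S. f s (l s)) = (\<Prod>B\<in>P. \<Prod>s\<in>B. f s (l s))"
      by (rule prod.partition[OF S P])
    also have "\<dots> = (\<Prod>B\<in>P. \<Prod>s\<in>B. f s ((\<lambda>B\<in>P. l (rep B)) B))"
      by (intro prod.cong refl) (simp add: block_constantD[OF bc _ _ rep])
    finally show "(\<Prod>B\<in>P. \<Prod>s\<in>B. f s ((\<lambda>B\<in>P. l (rep B)) B)) = (\<Prod>s\<in>S. f s (l s))" by simp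
  next
    fix h assume h: "h \<in> P \<rightarrow>\<^sub>E N"
    show "(\<lambda>B\<in>P. (\<lambda>s\<in>S. h (blk s)) (rep B)) = h"
    proof
      fix B
      show "(\<lambda>B\<in>P. (\<lambda>s\<in>S. h (blk s)) (rep B)) B = h B"
      proof (cases "B \<in> P")
        case True
        then show ?thesis using rep[OF True] sub[OF True] blk_eq[OF True] by simp
      qed (use h in \<open>simp add: PiE_def extensional_def\<close>)
    qed
    have "(\<lambda>s\<in>S. h (blk s)) \<in> S \<rightarrow>\<^sub>E N"
      using h blk by auto
    moreover have "block_constant P (\<lambda>s\<in>S. h (blk s))"
      unfolding block_constant_def using sub blk_eq by auto
    ultimately show "(\<lambda>s\<in>S. h (blk s)) \<in> {l \<in> S \<rightarrow>\<^sub>E N. block_constant P l}" by simp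
  qed
  also have "\<dots> = (\<Prod>B\<in>P. \<Sum>v\<in>N. \<Prod>s\<in>B. f s v)"
    using finP N by (intro prod_sum_PiE[symmetric]) auto
  finally show ?thesis .
qed

lemma block_constant_iff_pairing_delta:
  assumes "\<pi> \<in> pairings k" "length is = 2 * k"
  shows "pairing_delta \<pi> is \<longleftrightarrow> block_constant \<pi> (\<lambda>s\<in>{..<2 * k}. is ! s)"
proof -
  have "B \<subseteq> {..<2 * k}" if "B \<in> \<pi>" for B
    using assms that by (auto simp: pairings_def partition_on_def)
  then show ?thesis
    unfolding pairing_delta_def block_constant_def
    by (intro ball_cong refl) (auto simp: restrict_def)
qed

section \<open>Elementary facts on pairings\<close>

lemma pairings_partition_on: "\<pi> \<in> pairings k \<Longrightarrow> partition_on {..<2 * k} \<pi>"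
  by (simp add: pairings_def)

lemma pairing_subset: "\<pi> \<in> pairings k \<Longrightarrow> B \<in> \<pi> \<Longrightarrow> B \<subseteq> {..<2 * k}"
  using partition_onD1[OF pairings_partition_on] by blast

lemma finite_pairings: "finite (pairings k)"
proof (rule finite_subset)
  show "pairings k \<subseteq> Pow (Pow {..<2 * k})"
    by (auto simp: pairings_def partition_on_def)
qed simp

lemma finite_pairing: "\<pi> \<in> pairings k \<Longrightarrow> finite \<pi>"
proof (rule finite_UnionD)
  assume "\<pi> \<in> pairings k"
  then show "finite (\<Union>\<pi>)"
    using partition_onD1[OF pairings_partition_on, of \<pi> k] by (metis finite_lessThan)
qed

lemma card_pairing:
  assumes "\<pi> \<in> pairings k"
  shows "card \<pi> = k"
proof -
  have "card {..<2 * k} = (\<Sum>B\<in>\<pi>. card B)"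
    using assms by (intro product_partition) (auto simp: pairings_def intro: card_ge_0_finite)
  also have "\<dots> = 2 * card \<pi>"
    using assms by (simp add: pairings_def)
  finally show ?thesis by simp
qed

text \<open>All blocks have size 2, so containment of blocks is equality, and both pairings have
  \<open>k\<close> blocks. This is the criterion used to identify pairings, for the strict bound on
  loops and for kernels of indices.\<close>

lemma pairings_refine_imp_eq:
  assumes "\<pi> \<in> pairings k" "\<sigma> \<in> pairings k" and ref: "\<And>B. B \<in> \<pi> \<Longrightarrow> \<exists>C\<in>\<sigma>. B \<subseteq> C"
  shows "\<pi> = \<sigma>"
proof (rule card_subset_eq[OF finite_pairing[OF assms(2)]])
  show "\<pi> \<subseteq> \<sigma>"
  proof
    fix B assume B: "B \<in> \<pi>"
    then obtain C where C: "C \<in> \<sigma>" "B \<subseteq> C" using ref by blast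
    moreover have "card B = 2" "card C = 2"
      using B C assms by (auto simp: pairings_def)
    ultimately have "B = C" by (metis card_subset_eq card.infinite zero_neq_numeral)
    with C show "B \<in> \<sigma>" by simp
  qed
  show "card \<pi> = card \<sigma>" using assms by (simp add: card_pairing)
qed

section \<open>The join of two pairings, whose blocks are the loops of their superposition\<close>

definition joint_classes :: "nat \<Rightarrow> nat set set \<Rightarrow> nat set set \<Rightarrow> nat set set" where
  "joint_classes k \<pi> \<sigma> = {..<2 * k} // (joined \<pi> \<sigma>)\<^sup>*"

context
  fixes k :: nat and \<pi> \<sigma> :: "nat set set"
  assumes \<pi>: "\<pi> \<in> pairings k" and \<sigma>: "\<sigma> \<in> pairings k"
begin

lemma equiv_joined_rtrancl: "equiv UNIV ((joined \<pi> \<sigma>)\<^sup>*)"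
proof -
  have "sym (joined \<pi> \<sigma>)" by (auto simp: joined_def sym_def)
  then show ?thesis
    by (simp add: equiv_def refl_rtrancl sym_rtrancl trans_rtrancl)
qed

lemma joined_rtrancl_closed: "(s, t) \<in> (joined \<pi> \<sigma>)\<^sup>* \<Longrightarrow> s \<in> {..<2 * k} \<Longrightarrow> t \<in> {..<2 * k}"
proof (induction rule: rtrancl_induct)
  case (step y z)
  then show ?case
    using \<pi> \<sigma> by (fastforce simp: joined_def pairings_def partition_on_def)
qed

lemma joint_classes_partition_on: "partition_on {..<2 * k} (joint_classes k \<pi> \<sigma>)"
proof (rule partition_onI)
  show "\<Union> (joint_classes k \<pi> \<sigma>) = {..<2 * k}"
    using joined_rtrancl_closed by (fastforce simp: joint_classes_def quotient_def)
  show "{} \<notin> joint_classes k \<pi> \<sigma>"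
    by (auto simp: joint_classes_def quotient_def)
  show "disjnt p q" if "p \<in> joint_classes k \<pi> \<sigma>" "q \<in> joint_classes k \<pi> \<sigma>" "p \<noteq> q" for p q
  proof -
    have "p \<in> UNIV // (joined \<pi> \<sigma>)\<^sup>*" "q \<in> UNIV // (joined \<pi> \<sigma>)\<^sup>*"
      using that by (auto simp: joint_classes_def quotient_def)
    then show ?thesis
      using quotient_disj[OF equiv_joined_rtrancl] that by (auto simp: disjnt_def)
  qed
qed

text \<open>A labelling that is constant on the edges is constant along walks, and each edge lies
  inside one class. Hence the product of two delta tensors is the delta of the join.\<close>

lemma block_constant_joint_classes:
  "block_constant (joint_classes k \<pi> \<sigma>) l \<longleftrightarrow> block_constant \<pi> l \<and> block_constant \<sigma> l"
proof
  assume l: "block_constant (joint_classes k \<pi> \<sigma>) l"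
  have "l s = l t" if B: "B \<in> \<pi> \<union> \<sigma>" and st: "s \<in> B" "t \<in> B" for B s t
  proof (rule block_constantD[OF l])
    have "s \<in> {..<2 * k}"
      using B st(1) pairing_subset[OF \<pi>] pairing_subset[OF \<sigma>] by blast
    then show "(joined \<pi> \<sigma>)\<^sup>* `` {s} \<in> joint_classes k \<pi> \<sigma>"
      unfolding joint_classes_def by (rule quotientI)
    show "s \<in> (joined \<pi> \<sigma>)\<^sup>* `` {s}" by simp
    have "(s, t) \<in> joined \<pi> \<sigma>" using B st by (auto simp: joined_def)
    then show "t \<in> (joined \<pi> \<sigma>)\<^sup>* `` {s}" by blast
  qed
  then show "block_constant \<pi> l \<and> block_constant \<sigma> l"
    by (meson UnI1 UnI2 block_constant_def)
next
  assume l: "block_constant \<pi> l \<and> block_constant \<sigma> l"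
  have *: "l s = l t" if "(s, t) \<in> (joined \<pi> \<sigma>)\<^sup>*" for s t
    using that
  proof (induction rule: rtrancl_induct)
    case (step y z)
    then show ?case
      using l by (auto simp: joined_def dest: block_constantD)
  qed simp
  show "block_constant (joint_classes k \<pi> \<sigma>) l"
    unfolding block_constant_def
  proof (intro ballI)
    fix C s t assume "C \<in> joint_classes k \<pi> \<sigma>" "s \<in> C" "t \<in> C"
    then obtain r where "(r, s) \<in> (joined \<pi> \<sigma>)\<^sup>*" "(r, t) \<in> (joined \<pi> \<sigma>)\<^sup>*"
      by (auto simp: joint_classes_def quotient_def)
    then have "l r = l s" "l r = l t" by (auto intro: *)
    then show "l s = l t" by simp
  qed
qed

text \<open>Every class contains a block of \<open>\<pi>\<close>, so \<open>cl\<close> maps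
  \<open>\<pi>\<close> onto the classes. If there are \<open>k\<close> classes, this map is
  injective, each block of \<open>\<sigma>\<close> then stays inside one block of
  \<open>\<pi>\<close>, and the pairings coincide.\<close>

lemma loops_bounds:
  shows "loops k \<pi> \<sigma> \<le> k" and "\<pi> \<noteq> \<sigma> \<Longrightarrow> loops k \<pi> \<sigma> < k"
proof -
  let ?R = "(joined \<pi> \<sigma>)\<^sup>*"
  define cl where "cl B = ?R `` B" for B
  have step: "(s, t) \<in> ?R" if "B \<in> \<pi> \<union> \<sigma>" "s \<in> B" "t \<in> B" for B s t
    using that by (auto simp: joined_def intro!: r_into_rtrancl)
  \<comment> \<open>The points of a block are equivalent, so the set reached from the block is the
    class of any of its points.\<close>
  have cl: "cl B = ?R `` {s}" if "B \<in> \<pi>" "s \<in> B" for B s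
  proof -
    have "?R `` {t} = ?R `` {s}" if "t \<in> B" for t
      using equiv_class_eq[OF equiv_joined_rtrancl] step \<open>B \<in> \<pi>\<close> \<open>s \<in> B\<close> that by (metis UnI1)
    moreover have "cl B = (\<Union>t\<in>B. ?R `` {t})"
      unfolding cl_def by (rule Image_eq_UN)
    ultimately show ?thesis
      using \<open>s \<in> B\<close> by blast
  qed
  have img: "joint_classes k \<pi> \<sigma> \<subseteq> cl ` \<pi>"
  proof
    fix C assume "C \<in> joint_classes k \<pi> \<sigma>"
    then obtain s where s: "s \<in> {..<2 * k}" "C = ?R `` {s}"
      by (auto simp: joint_classes_def quotient_def)
    then obtain B where "B \<in> \<pi>" "s \<in> B"
      using \<pi> by (auto simp: pairings_def partition_on_def)
    with cl s show "C \<in> cl ` \<pi>" by blast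
  qed
  have le: "loops k \<pi> \<sigma> \<le> card (cl ` \<pi>)"
    unfolding loops_def joint_classes_def[symmetric]
    by (intro card_mono img finite_imageI finite_pairing[OF \<pi>])
  also have "\<dots> \<le> k"
    using card_image_le[OF finite_pairing[OF \<pi>]] card_pairing[OF \<pi>] by metis
  finally show "loops k \<pi> \<sigma> \<le> k" .
  show "loops k \<pi> \<sigma> < k" if ne: "\<pi> \<noteq> \<sigma>"
  proof -
    have "\<not> inj_on cl \<pi>"
    proof
      assume inj: "inj_on cl \<pi>"
      have "\<exists>C\<in>\<pi>. B \<subseteq> C" if B: "B \<in> \<sigma>" for B
      proof -
        obtain s where s: "s \<in> B" using \<sigma> B by (force simp: pairings_def partition_on_def)
        have ex: "\<exists>C\<in>\<pi>. t \<in> C" if "t \<in> B" for t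
          using pairing_subset[OF \<sigma> B] that partition_onD1[OF pairings_partition_on[OF \<pi>]] by blast
        then obtain C where C: "C \<in> \<pi>" "s \<in> C" using s by blast
        have "t \<in> C" if t: "t \<in> B" for t
        proof -
          obtain D where D: "D \<in> \<pi>" "t \<in> D" using ex t by blast
          have "?R `` {t} = ?R `` {s}"
            using equiv_class_eq[OF equiv_joined_rtrancl step] B s t by (metis UnI2)
          then have "cl D = cl C" using cl C D by metis
          then show ?thesis using inj C D by (auto dest: inj_onD)
        qed
        with C show ?thesis by blast
      qed
      then have "\<sigma> = \<pi>" by (rule pairings_refine_imp_eq[OF \<sigma> \<pi>])
      with ne show False by simp
    qed
    then have "card (cl ` \<pi>) \<noteq> card \<pi>"
      using eq_card_imp_inj_on finite_pairing[OF \<pi>] by blast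
    moreover have "card (cl ` \<pi>) \<le> card \<pi>"
      by (rule card_image_le[OF finite_pairing[OF \<pi>]])
    ultimately show ?thesis using le card_pairing[OF \<pi>] by simp
  qed
qed

lemma brauer_dist_pos: "\<pi> \<noteq> \<sigma> \<Longrightarrow> 0 < brauer_dist k \<pi> \<sigma>"
  using loops_bounds(2) unfolding brauer_dist_def by linarith

lemma power_loops:
  assumes "n > 0"
  shows "real n ^ loops k \<pi> \<sigma> = real n ^ k / real n ^ brauer_dist k \<pi> \<sigma>"
proof -
  have "real n ^ brauer_dist k \<pi> \<sigma> * real n ^ loops k \<pi> \<sigma> = real n ^ k"
    using loops_bounds(1) unfolding brauer_dist_def by (simp flip: power_add)
  then show ?thesis using assms by (simp add: field_simps)
qed

text \<open>The Gram matrix of the delta tensors: the inner product counts labellings constant on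
  the join, with \<open>n\<close> choices for each loop.\<close>

lemma sum_block_constant_pairings:
  "(\<Sum>l\<in>{..<2 * k} \<rightarrow>\<^sub>E {..<n}. of_bool (block_constant \<pi> l) * of_bool (block_constant \<sigma> l)) =
    real n ^ loops k \<pi> \<sigma>"
proof -
  have "(\<Sum>l\<in>{..<2 * k} \<rightarrow>\<^sub>E {..<n}. of_bool (block_constant (joint_classes k \<pi> \<sigma>) l)) =
      real n ^ card (joint_classes k \<pi> \<sigma>)"
    using sum_block_constant[OF _ joint_classes_partition_on, of "{..<n}" "\<lambda>_ _. 1"] by simp
  then show ?thesis
    unfolding block_constant_joint_classes of_bool_conj by (simp add: loops_def joint_classes_def)
qed

end

lemma prod_of_bool:
  "finite A \<Longrightarrow> (\<Prod>x\<in>A. of_bool (P x)) = (of_bool (\<forall>x\<in>A. P x) :: real)"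
proof (induction A rule: finite_induct)
  case (insert x A)
  then show ?case by (cases "P x") simp_all
qed simp

text \<open>On a block {s,t} the common value is summed out, leaving the inner product of
  \<open>f s\<close> and \<open>f t\<close>, a Kronecker delta. With rows of \<open>g\<close> this
  proves invariance of the delta tensors; with columns of \<open>u\<close> it evaluates the
  contractions of the moments.\<close>

lemma sum_pairing_prod:
  fixes f :: "nat \<Rightarrow> nat \<Rightarrow> real"
  assumes \<pi>: "\<pi> \<in> pairings k"
    and orth: "\<And>s t. s < 2 * k \<Longrightarrow> t < 2 * k \<Longrightarrow> (\<Sum>v<n. f s v * f t v) = of_bool (c s = c t)"
  shows "(\<Sum>l\<in>{..<2 * k} \<rightarrow>\<^sub>E {..<n}. of_bool (block_constant \<pi> l) * (\<Prod>s<2 * k. f s (l s))) =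
    of_bool (block_constant \<pi> c)"
proof -
  have "(\<Sum>v<n. \<Prod>s\<in>B. f s v) = of_bool (\<forall>s\<in>B. \<forall>t\<in>B. c s = c t)" if B: "B \<in> \<pi>" for B
  proof -
    obtain s t where st: "B = {s, t}" "s \<noteq> t"
      using \<pi> B by (auto simp: pairings_def card_2_iff)
    moreover have "s < 2 * k" "t < 2 * k"
      using pairing_subset[OF \<pi> B] st by auto
    ultimately have "(\<Sum>v<n. f s v * f t v) = of_bool (c s = c t)"
      by (intro orth)
    moreover have "(\<forall>s\<in>B. \<forall>t\<in>B. c s = c t) \<longleftrightarrow> c s = c t"
      using st by auto
    ultimately show ?thesis using st by simp
  qed
  then have "(\<Prod>B\<in>\<pi>. \<Sum>v<n. \<Prod>s\<in>B. f s v) = (\<Prod>B\<in>\<pi>. of_bool (\<forall>s\<in>B. \<forall>t\<in>B. c s = c t))"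
    by (intro prod.cong) auto
  also have "\<dots> = of_bool (block_constant \<pi> c)"
    unfolding block_constant_def by (rule prod_of_bool[OF finite_pairing[OF \<pi>]])
  finally show ?thesis
    using sum_block_constant[OF _ pairings_partition_on[OF \<pi>], of "{..<n}" f] by simp
qed

section \<open>Invariant tensors\<close>

text \<open>Orthogonal matrices as plain functions, given by the row condition; for square matrices
  it implies the column condition, which \<open>orthonormal_rows_imp_orthogonal_group\<close>
  recovers.\<close>

definition orthonormal_rows :: "nat \<Rightarrow> (nat \<Rightarrow> nat \<Rightarrow> real) \<Rightarrow> bool" where
  "orthonormal_rows n g \<longleftrightarrow> (\<forall>u<n. \<forall>w<n. (\<Sum>v<n. g u v * g w v) = of_bool (u = w))"

text \<open>Fixed vectors of the orthogonal group on the m-fold tensor power of R^n, in coordinates.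
  Multi-indices are extensional functions, so that each has a unique representation.\<close>

definition invariant_tensor :: "nat \<Rightarrow> nat \<Rightarrow> ((nat \<Rightarrow> nat) \<Rightarrow> real) \<Rightarrow> bool" where
  "invariant_tensor m n T \<longleftrightarrow> (\<forall>g. orthonormal_rows n g \<longrightarrow>
    (\<forall>i\<in>{..<m} \<rightarrow>\<^sub>E {..<n}. (\<Sum>l\<in>{..<m} \<rightarrow>\<^sub>E {..<n}. (\<Prod>s<m. g (i s) (l s)) * T l) = T i))"

lemma finite_indices: "finite ({..<m::nat} \<rightarrow>\<^sub>E {..<n::nat})"
  by (simp add: finite_PiE)

lemma invariant_tensor_pairing:
  assumes "\<pi> \<in> pairings k"
  shows "invariant_tensor (2 * k) n (\<lambda>l. of_bool (block_constant \<pi> l))"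
  unfolding invariant_tensor_def
proof (intro allI impI ballI)
  fix g i assume g: "orthonormal_rows n g" and i: "i \<in> {..<2 * k} \<rightarrow>\<^sub>E {..<n}"
  have "i s < n" if "s < 2 * k" for s using PiE_mem[OF i, of s] that by simp
  then have "(\<Sum>l\<in>{..<2 * k} \<rightarrow>\<^sub>E {..<n}. of_bool (block_constant \<pi> l) * (\<Prod>s<2 * k. g (i s) (l s))) =
      of_bool (block_constant \<pi> i)"
    using g by (intro sum_pairing_prod[OF assms]) (simp add: orthonormal_rows_def)
  then show "(\<Sum>l\<in>{..<2 * k} \<rightarrow>\<^sub>E {..<n}. (\<Prod>s<2 * k. g (i s) (l s)) * of_bool (block_constant \<pi> l)) =
      of_bool (block_constant \<pi> i)"
    by (simp only: mult.commute)
qed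

lemma invariant_tensor_diff:
  assumes "invariant_tensor m n T" "invariant_tensor m n U"
  shows "invariant_tensor m n (\<lambda>i. T i - U i)"
  using assms by (simp add: invariant_tensor_def right_diff_distrib sum_subtractf)

lemma invariant_tensor_sum:
  assumes "\<And>x. x \<in> A \<Longrightarrow> invariant_tensor m n (T x)"
  shows "invariant_tensor m n (\<lambda>i. \<Sum>x\<in>A. c x * T x i)"
  unfolding invariant_tensor_def
proof (intro allI impI ballI)
  fix g i assume g: "orthonormal_rows n g" and i: "i \<in> {..<m} \<rightarrow>\<^sub>E {..<n}"
  let ?I = "{..<m} \<rightarrow>\<^sub>E {..<n}"
  have "(\<Sum>l\<in>?I. (\<Prod>s<m. g (i s) (l s)) * (\<Sum>x\<in>A. c x * T x l)) =
      (\<Sum>x\<in>A. c x * (\<Sum>l\<in>?I. (\<Prod>s<m. g (i s) (l s)) * T x l))"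
    by (simp add: sum_distrib_left mult.left_commute sum.swap[of _ A])
  also have "\<dots> = (\<Sum>x\<in>A. c x * T x i)"
    by (intro sum.cong refl) (use assms g i in \<open>simp add: invariant_tensor_def\<close>)
  finally show "(\<Sum>l\<in>?I. (\<Prod>s<m. g (i s) (l s)) * (\<Sum>x\<in>A. c x * T x l)) = (\<Sum>x\<in>A. c x * T x i)" .
qed

text \<open>A signed permutation matrix has one nonzero entry in each row, so the transformed tensor
  collapses to a single term. Taking \<open>h\<close> the identity gives sign changes, and
  \<open>\<epsilon>\<close> constantly 1 gives permutations of the values.\<close>

lemma invariant_tensor_signed_permutation:
  assumes inv: "invariant_tensor m n T" and h: "bij_betw h {..<n} {..<n}"
    and \<epsilon>: "\<And>v. \<epsilon> v * \<epsilon> v = (1 :: real)" and i: "i \<in> {..<m} \<rightarrow>\<^sub>E {..<n}"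
  shows "T i = (\<Prod>s<m. \<epsilon> (i s)) * T (\<lambda>s\<in>{..<m}. h (i s))"
proof -
  define g where "g u v = (if v = h u then \<epsilon> u else 0)" for u v
  define i' where "i' = (\<lambda>s\<in>{..<m}. h (i s))"
  have hn: "h u < n" if "u < n" for u
    using bij_betwE[OF h] that by simp
  have "orthonormal_rows n g"
    unfolding orthonormal_rows_def
  proof (intro allI impI)
    fix u w assume uw: "u < n" "w < n"
    have "(\<Sum>v<n. g u v * g w v) = (\<Sum>v<n. if v = h u then \<epsilon> u * g w v else 0)"
      by (intro sum.cong) (simp_all add: g_def)
    also have "\<dots> = \<epsilon> u * g w (h u)"
      using hn uw by simp
    also have "\<dots> = of_bool (u = w)"
      using bij_betw_imp_inj_on[OF h] uw by (auto simp: g_def \<epsilon> dest: inj_onD)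
    finally show "(\<Sum>v<n. g u v * g w v) = of_bool (u = w)" .
  qed
  then have "T i = (\<Sum>l\<in>{..<m} \<rightarrow>\<^sub>E {..<n}. (\<Prod>s<m. g (i s) (l s)) * T l)"
    using inv i by (simp add: invariant_tensor_def)
  also have "\<dots> = (\<Sum>l\<in>{..<m} \<rightarrow>\<^sub>E {..<n}. if l = i' then (\<Prod>s<m. \<epsilon> (i s)) * T i' else 0)"
  proof (intro sum.cong refl)
    fix l assume l: "l \<in> {..<m} \<rightarrow>\<^sub>E {..<n}"
    show "(\<Prod>s<m. g (i s) (l s)) * T l = (if l = i' then (\<Prod>s<m. \<epsilon> (i s)) * T i' else 0)"
    proof (cases "l = i'")
      case True
      then have "(\<Prod>s<m. g (i s) (l s)) = (\<Prod>s<m. \<epsilon> (i s))"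
        by (intro prod.cong) (simp_all add: g_def i'_def)
      then show ?thesis using True by simp
    next
      case False
      have "i' \<in> {..<m} \<rightarrow>\<^sub>E {..<n}"
        using hn i by (auto simp: i'_def)
      then obtain s where "s < m" "l s \<noteq> i' s"
        using False PiE_ext[OF l, of i'] by auto
      then have "\<exists>s\<in>{..<m}. g (i s) (l s) = 0"
        by (intro bexI[of _ s]) (auto simp: g_def i'_def)
      then show ?thesis using False by simp
    qed
  qed
  also have "\<dots> = (\<Prod>s<m. \<epsilon> (i s)) * T i'"
    using hn i by (auto simp: i'_def finite_indices)
  finally show ?thesis by (simp add: i'_def)
qed

section \<open>Infinitesimal rotations in a coordinate plane\<close>

definition plane_rotation :: "nat \<Rightarrow> nat \<Rightarrow> real \<Rightarrow> nat \<Rightarrow> nat \<Rightarrow> real" where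
  "plane_rotation a b \<theta> u v =
    (if u = a then if v = a then cos \<theta> else if v = b then sin \<theta> else 0
     else if u = b then if v = a then - sin \<theta> else if v = b then cos \<theta> else 0
     else of_bool (u = v))"

lemma sum_plane_rotation:
  assumes "a < n" "b < n" "a \<noteq> b" "u < n"
  shows "(\<Sum>v<n. plane_rotation a b \<theta> u v * f v) =
    (if u = a then cos \<theta> * f a + sin \<theta> * f b
     else if u = b then cos \<theta> * f b - sin \<theta> * f a else f u)"
proof (cases "u = a \<or> u = b")
  case True
  have "(\<Sum>v<n. plane_rotation a b \<theta> u v * f v) = (\<Sum>v\<in>{a, b}. plane_rotation a b \<theta> u v * f v)"
    using assms True by (intro sum.mono_neutral_right) (auto simp: plane_rotation_def)
  then show ?thesis using assms True by (auto simp: plane_rotation_def)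
next
  case False
  then have "(\<Sum>v<n. plane_rotation a b \<theta> u v * f v) = (\<Sum>v\<in>{u}. plane_rotation a b \<theta> u v * f v)"
    using assms by (intro sum.mono_neutral_right) (auto simp: plane_rotation_def)
  then show ?thesis using False by (simp add: plane_rotation_def)
qed

lemma orthonormal_rows_plane_rotation:
  assumes "a < n" "b < n" "a \<noteq> b"
  shows "orthonormal_rows n (plane_rotation a b \<theta>)"
  unfolding orthonormal_rows_def
proof (intro allI impI)
  fix u w assume "u < n" "w < n"
  then show "(\<Sum>v<n. plane_rotation a b \<theta> u v * plane_rotation a b \<theta> w v) = of_bool (u = w)"
    using assms sin_cos_squared_add[of \<theta>]
    by (subst sum_plane_rotation) (auto simp: plane_rotation_def power2_eq_square algebra_simps)
qed

text \<open>The Kronecker deltas leave only those \<open>l\<close> that agree with \<open>i\<close>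
  away from position \<open>s\<close>. This is the shape of each summand in the product rule at the
  identity matrix.\<close>

lemma sum_single_update:
  fixes T :: "(nat \<Rightarrow> nat) \<Rightarrow> real"
  assumes i: "i \<in> {..<m} \<rightarrow>\<^sub>E {..<n}" and s: "s < m"
  shows "(\<Sum>l\<in>{..<m} \<rightarrow>\<^sub>E {..<n}. J (l s) * (\<Prod>t\<in>{..<m} - {s}. of_bool (i t = l t)) * T l) =
    (\<Sum>v<n. J v * T (i(s := v)))"
proof -
  let ?upd = "\<lambda>v. i(s := v)"
  have sub: "?upd ` {..<n} \<subseteq> {..<m} \<rightarrow>\<^sub>E {..<n}"
    using i s by (auto simp: PiE_def Pi_def extensional_def)
  have "(\<Sum>l\<in>{..<m} \<rightarrow>\<^sub>E {..<n}. J (l s) * (\<Prod>t\<in>{..<m} - {s}. of_bool (i t = l t)) * T l) =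
      (\<Sum>l\<in>?upd ` {..<n}. J (l s) * (\<Prod>t\<in>{..<m} - {s}. of_bool (i t = l t)) * T l)"
  proof (rule sum.mono_neutral_right[OF finite_indices sub], intro ballI)
    fix l assume l: "l \<in> ({..<m} \<rightarrow>\<^sub>E {..<n}) - ?upd ` {..<n}"
    have "\<exists>t\<in>{..<m} - {s}. i t \<noteq> l t"
    proof (rule ccontr)
      assume eq: "\<not> (\<exists>t\<in>{..<m} - {s}. i t \<noteq> l t)"
      have ls: "l s \<in> {..<n}" using l s by (auto dest: PiE_mem)
      then have "l = ?upd (l s)"
        using eq l sub by (intro PiE_ext[of l "{..<m}" "\<lambda>_. {..<n}"]) auto
      with ls l show False by blast
    qed
    then have "(\<Prod>t\<in>{..<m} - {s}. of_bool (i t = l t)) = (0 :: real)"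
      by (intro prod_zero) auto
    then show "J (l s) * (\<Prod>t\<in>{..<m} - {s}. of_bool (i t = l t)) * T l = 0" by simp
  qed
  also have "\<dots> = (\<Sum>v<n. J v * T (i(s := v)))"
    by (subst sum.reindex) (auto intro!: inj_onI dest: fun_upd_eqD)
  finally show ?thesis .
qed

text \<open>By invariance, the tensor transformed by the rotation of angle \<open>\<theta>\<close>
  does not depend on \<open>\<theta>\<close>. The identity is the vanishing of its derivative at
  angle 0.\<close>

lemma invariant_tensor_rotation:
  assumes inv: "invariant_tensor m n T" and ab: "a < n" "b < n" "a \<noteq> b"
    and i: "i \<in> {..<m} \<rightarrow>\<^sub>E {..<n}"
  shows "(\<Sum>s<m. of_bool (i s = a) * T (i(s := b)) - of_bool (i s = b) * T (i(s := a))) = 0"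
proof -
  let ?I = "{..<m} \<rightarrow>\<^sub>E {..<n}"
  \<comment> \<open>The derivative of the rotation matrix at angle 0, that is, the skew-symmetric
    generator E_ab - E_ba.\<close>
  define J where "J u v = (if u = a \<and> v = b then 1 else if u = b \<and> v = a then - 1 else 0 :: real)" for u v
  have D: "((\<lambda>\<theta>. plane_rotation a b \<theta> u v) has_field_derivative J u v) (at 0)" for u v
    using ab by (cases "u = a"; cases "u = b"; cases "v = a"; cases "v = b")
      (auto simp: plane_rotation_def J_def intro!: derivative_eq_intros)
  have g0: "plane_rotation a b 0 u v = of_bool (u = v)" for u v
    using ab by (auto simp: plane_rotation_def)
  have deriv: "((\<lambda>\<theta>. \<Sum>l\<in>?I. (\<Prod>s<m. plane_rotation a b \<theta> (i s) (l s)) * T l) has_field_derivative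
      (\<Sum>l\<in>?I. (\<Sum>s<m. J (i s) (l s) * (\<Prod>t\<in>{..<m} - {s}. plane_rotation a b 0 (i t) (l t))) * T l)) (at 0)"
    by (intro DERIV_sum DERIV_cmult_right has_field_derivative_prod D)
  have const: "(\<lambda>\<theta>. \<Sum>l\<in>?I. (\<Prod>s<m. plane_rotation a b \<theta> (i s) (l s)) * T l) = (\<lambda>_. T i)"
    using inv i orthonormal_rows_plane_rotation[OF ab] by (auto simp: invariant_tensor_def)
  have "0 = (\<Sum>l\<in>?I. (\<Sum>s<m. J (i s) (l s) * (\<Prod>t\<in>{..<m} - {s}. of_bool (i t = l t))) * T l)"
    by (rule DERIV_unique[OF DERIV_const deriv[unfolded g0 const]])
  also have "\<dots> = (\<Sum>s<m. \<Sum>l\<in>?I. J (i s) (l s) * (\<Prod>t\<in>{..<m} - {s}. of_bool (i t = l t)) * T l)"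
    unfolding sum_distrib_right by (rule sum.swap)
  also have "\<dots> = (\<Sum>s<m. \<Sum>v<n. J (i s) v * T (i(s := v)))"
    by (intro sum.cong refl sum_single_update[OF i]) simp
  also have "\<dots> = (\<Sum>s<m. of_bool (i s = a) * T (i(s := b)) - of_bool (i s = b) * T (i(s := a)))"
  proof (intro sum.cong refl)
    fix s
    have "(\<Sum>v<n. J (i s) v * T (i(s := v))) =
        (\<Sum>v<n. (if v = b then of_bool (i s = a) * T (i(s := b)) else 0) -
          (if v = a then of_bool (i s = b) * T (i(s := a)) else 0))"
      using ab by (intro sum.cong refl) (auto simp: J_def)
    also have "\<dots> = of_bool (i s = a) * T (i(s := b)) - of_bool (i s = b) * T (i(s := a))"
      using ab by (simp add: sum_subtractf)
    finally show "(\<Sum>v<n. J (i s) v * T (i(s := v))) =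
        of_bool (i s = a) * T (i(s := b)) - of_bool (i s = b) * T (i(s := a))" .
  qed
  finally show ?thesis by simp
qed

section \<open>Multiplicities of index values and vanishing of invariant tensors\<close>

definition fibre :: "nat \<Rightarrow> (nat \<Rightarrow> nat) \<Rightarrow> nat \<Rightarrow> nat set" where
  "fibre m i v = {s. s < m \<and> i s = v}"

lemma finite_fibre [simp]: "finite (fibre m i v)"
  by (simp add: fibre_def)

lemma sum_card_fibre: "(\<Sum>v\<in>i ` {..<m}. card (fibre m i v)) = m"
proof -
  have "m = (\<Sum>s<m. 1)" by simp
  also have "\<dots> = (\<Sum>v\<in>i ` {..<m}. \<Sum>s\<in>{s \<in> {..<m}. i s = v}. 1)"
    by (rule sum.image_gen) simp
  finally show ?thesis by (simp add: fibre_def)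
qed

text \<open>Flipping the sign of coordinate \<open>v\<close> multiplies the entry by -1 to the
  multiplicity of \<open>v\<close>, so an odd multiplicity gives T i = -T i.\<close>

lemma invariant_tensor_odd_fibre:
  assumes inv: "invariant_tensor m n T" and i: "i \<in> {..<m} \<rightarrow>\<^sub>E {..<n}" and odd: "odd (card (fibre m i v))"
  shows "T i = 0"
proof -
  have "(\<Prod>s<m. if i s = v then - 1 else 1 :: real) = (- 1) ^ card (fibre m i v)"
    by (simp add: prod.If_cases fibre_def Collect_conj_eq lessThan_def)
  moreover have "(\<lambda>s\<in>{..<m}. id (i s)) = i"
    using i by auto
  moreover have "T i = (\<Prod>s<m. if i s = v then - 1 else 1) * T (\<lambda>s\<in>{..<m}. id (i s))"
    by (rule invariant_tensor_signed_permutation[OF inv bij_betw_id _ i]) simp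
  ultimately show ?thesis using odd by simp
qed

text \<open>Moving one element of a fibre of size at least four to an unused value \<open>b\<close> and differentiating
  the invariance under rotations of the \<open>a\<close>-\<open>b\<close>-plane expresses \<open>T i\<close> through indices with more
  values than \<open>i\<close>.\<close>

lemma invariant_tensor_eq_0:
  assumes inv: "invariant_tensor (2 * k) n T" and "k \<le> n"
    and pair: "\<And>i. i \<in> {..<2 * k} \<rightarrow>\<^sub>E {..<n} \<Longrightarrow> (\<And>s. s < 2 * k \<Longrightarrow> card (fibre (2 * k) i (i s)) = 2) \<Longrightarrow> T i = 0"
  shows "i \<in> {..<2 * k} \<rightarrow>\<^sub>E {..<n} \<Longrightarrow> T i = 0"
\<comment> \<open>The measure is the number of values in {..<n} that \<open>i\<close> does not
  take.\<close>
proof (induction "n - card (i ` {..<2 * k})" arbitrary: i rule: less_induct)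
  case less
  note i = less.prems
  let ?fib = "fibre (2 * k) i"
  show ?case
  proof (cases "\<exists>v. odd (card (?fib v))")
    case True
    then show ?thesis using invariant_tensor_odd_fibre[OF inv i] by blast
  next
    case False
    have ge2: "2 \<le> card (?fib v)" if "v \<in> i ` {..<2 * k}" for v
    proof -
      have "?fib v \<noteq> {}" using that by (auto simp: fibre_def)
      then have "card (?fib v) \<noteq> 0" by simp
      moreover have "even (card (?fib v))" using False by blast
      ultimately show ?thesis by (intro dvd_imp_le) (simp_all add: card_gt_0_iff)
    qed
    show ?thesis
    proof (cases "\<forall>s<2 * k. card (?fib (i s)) = 2")
      case True
      then show ?thesis using pair[OF i] by blast
    next
      case ne2: False
      then obtain s0 where s0: "s0 < 2 * k" "card (?fib (i s0)) \<noteq> 2" by blast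
      define a where "a = i s0"
      have a: "a \<in> i ` {..<2 * k}" "card (?fib a) > 2"
        using s0 ge2[of a] by (auto simp: a_def)
      have img: "i ` {..<2 * k} \<subseteq> {..<n}" using i by auto
      have "2 * card (i ` {..<2 * k}) = (\<Sum>v\<in>i ` {..<2 * k}. 2)" by simp
      also have "\<dots> < (\<Sum>v\<in>i ` {..<2 * k}. card (?fib v))"
        using a ge2 by (intro sum_strict_mono_ex1) auto
      finally have lt: "card (i ` {..<2 * k}) < k" by (simp add: sum_card_fibre)
      then have "i ` {..<2 * k} \<noteq> {..<n}" using \<open>k \<le> n\<close> by auto
      then obtain b where b: "b < n" "b \<notin> i ` {..<2 * k}" using img by blast
      \<comment> \<open>The rotation identity is applied at \<open>i'\<close>, not at
        \<open>i\<close>: the only position with value \<open>b\<close> is \<open>s0\<close>, and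
        resetting it to \<open>a\<close> restores \<open>i\<close>. All other terms move a further
        \<open>a\<close> to \<open>b\<close> and are covered by the induction hypothesis.\<close>
      define i' where "i' = i(s0 := b)"
      have an: "a < n" using a img by auto
      have ab: "a \<noteq> b" using a b by auto
      have i': "i' \<in> {..<2 * k} \<rightarrow>\<^sub>E {..<n}"
        using i b s0 by (auto simp: i'_def PiE_def Pi_def extensional_def)
      have zero: "T (i'(s := b)) = 0" if s: "s < 2 * k" "i' s = a" for s
      proof (rule less.hyps)
        show upd: "i'(s := b) \<in> {..<2 * k} \<rightarrow>\<^sub>E {..<n}"
          using i' b s by (auto simp: PiE_def Pi_def extensional_def)
        \<comment> \<open>A third position keeps the value \<open>a\<close> after two of them have
          moved to \<open>b\<close>, so no value is lost and \<open>b\<close> is gained.\<close>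
        have "\<not> ?fib a \<subseteq> {s0, s}"
        proof
          assume "?fib a \<subseteq> {s0, s}"
          then have "card (?fib a) \<le> card {s0, s}" by (intro card_mono) auto
          also have "\<dots> \<le> 2" by (simp add: card_insert_if)
          finally show False using a by simp
        qed
        then obtain s1 where s1: "s1 < 2 * k" "i s1 = a" "s1 \<noteq> s0" "s1 \<noteq> s"
          by (auto simp: fibre_def)
        have "insert b (i ` {..<2 * k}) \<subseteq> (i'(s := b)) ` {..<2 * k}"
        proof
          fix v assume "v \<in> insert b (i ` {..<2 * k})"
          then consider "v = b" | "v = a" | t where "t < 2 * k" "v = i t" "v \<noteq> a" by blast
          then show "v \<in> (i'(s := b)) ` {..<2 * k}"
          proof cases
            case 1 then show ?thesis using s by (intro image_eqI[of _ _ s]) auto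
          next
            case 2 then show ?thesis using s1 by (intro image_eqI[of _ _ s1]) (auto simp: i'_def)
          next
            case 3
            then have "t \<noteq> s0" "t \<noteq> s" using s ab by (auto simp: i'_def a_def split: if_splits)
            then show ?thesis using 3 by (intro image_eqI[of _ _ t]) (auto simp: i'_def)
          qed
        qed
        then have "card (insert b (i ` {..<2 * k})) \<le> card ((i'(s := b)) ` {..<2 * k})"
          by (intro card_mono) auto
        then show "n - card ((i'(s := b)) ` {..<2 * k}) < n - card (i ` {..<2 * k})"
          using b lt \<open>k \<le> n\<close> by simp
      qed
      have only: "i' s = b \<longleftrightarrow> s = s0" if "s < 2 * k" for s
        using b that by (auto simp: i'_def)
      have "0 = (\<Sum>s<2 * k. of_bool (i' s = a) * T (i'(s := b)) - of_bool (i' s = b) * T (i'(s := a)))"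
        by (rule invariant_tensor_rotation[OF inv an b(1) ab i', symmetric])
      also have "\<dots> = (\<Sum>s<2 * k. if s = s0 then - T (i'(s0 := a)) else 0)"
        using zero only ab by (intro sum.cong refl) auto
      also have "\<dots> = - T i"
        using s0 by (simp add: i'_def a_def)
      finally show ?thesis by simp
    qed
  qed
qed

text \<open>The values of \<open>i\<close> and \<open>j\<close> correspond under a bijection of the
  two images; the complements in {..<n} have equal size, so it extends to a permutation.\<close>

lemma index_permutation:
  fixes i j :: "nat \<Rightarrow> nat"
  assumes i: "i \<in> {..<m} \<rightarrow>\<^sub>E {..<n}" and j: "j \<in> {..<m} \<rightarrow>\<^sub>E {..<n}"
    and eq: "\<And>s t. s < m \<Longrightarrow> t < m \<Longrightarrow> i s = i t \<longleftrightarrow> j s = j t"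
  obtains h where "bij_betw h {..<n} {..<n}" "j = (\<lambda>s\<in>{..<m}. h (i s))"
proof -
  define h0 where "h0 v = j (inv_into {..<m} i v)" for v
  have h0: "h0 (i s) = j s" if "s < m" for s
  proof -
    have "inv_into {..<m} i (i s) < m" "i (inv_into {..<m} i (i s)) = i s"
      using that inv_into_into[of "i s" i "{..<m}"] f_inv_into_f[of "i s" i "{..<m}"] by auto
    then show ?thesis using eq that by (simp add: h0_def)
  qed
  have b0: "bij_betw h0 (i ` {..<m}) (j ` {..<m})"
    unfolding bij_betw_def
  proof
    show "inj_on h0 (i ` {..<m})" using h0 eq by (auto intro!: inj_onI)
    show "h0 ` i ` {..<m} = j ` {..<m}" using h0 by (force simp: image_image)
  qed
  have sub: "i ` {..<m} \<subseteq> {..<n}" "j ` {..<m} \<subseteq> {..<n}" using i j by auto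
  have "card ({..<n} - i ` {..<m}) = card ({..<n} - j ` {..<m})"
    using bij_betw_same_card[OF b0] card_Diff_subset[OF finite_imageI[OF finite_lessThan] sub(1)]
      card_Diff_subset[OF finite_imageI[OF finite_lessThan] sub(2)] by presburger
  then obtain h1 where h1: "bij_betw h1 ({..<n} - i ` {..<m}) ({..<n} - j ` {..<m})"
    using finite_same_card_bij by (metis finite_Diff finite_lessThan)
  define h where "h v = (if v \<in> i ` {..<m} then h0 v else h1 v)" for v
  have "bij_betw h (i ` {..<m} \<union> ({..<n} - i ` {..<m})) (j ` {..<m} \<union> ({..<n} - j ` {..<m}))"
    unfolding h_def by (rule bij_betw_disjoint_Un[OF b0 h1]) auto
  then have "bij_betw h {..<n} {..<n}" using sub by (simp add: Un_absorb1)
  moreover have "j = (\<lambda>s\<in>{..<m}. h (i s))"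
  proof
    fix s show "j s = (\<lambda>s\<in>{..<m}. h (i s)) s"
      using j h0 by (cases "s < m") (auto simp: h_def PiE_def extensional_def)
  qed
  ultimately show ?thesis by (rule that)
qed

section \<open>Kernels of indices and the span of the pairing tensors\<close>

definition index_kernel :: "nat \<Rightarrow> (nat \<Rightarrow> nat) \<Rightarrow> nat set set" where
  "index_kernel m i = (\<lambda>s. fibre m i (i s)) ` {..<m}"

lemma index_kernel_eq_iff:
  assumes "s < m" "t < m"
  shows "i s = i t \<longleftrightarrow> (\<exists>B\<in>index_kernel m i. s \<in> B \<and> t \<in> B)"
  using assms by (auto simp: index_kernel_def fibre_def)

lemma index_kernel_pairing:
  assumes "\<And>s. s < 2 * k \<Longrightarrow> card (fibre (2 * k) i (i s)) = 2"
  shows "index_kernel (2 * k) i \<in> pairings k"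
proof -
  have "partition_on {..<2 * k} (index_kernel (2 * k) i)"
    by (rule partition_onI) (auto simp: index_kernel_def fibre_def disjnt_def)
  then show ?thesis using assms by (auto simp: pairings_def index_kernel_def)
qed

text \<open>A pairing on whose blocks \<open>i\<close> is constant refines the kernel, and a
  refinement between pairings is an equality. So at an index with all multiplicities 2 exactly one
  delta tensor is nonzero, which allows coefficients to be read off there.\<close>

lemma block_constant_iff_index_kernel:
  assumes \<sigma>: "\<sigma> \<in> pairings k" and ker: "index_kernel (2 * k) i \<in> pairings k"
  shows "block_constant \<sigma> i \<longleftrightarrow> \<sigma> = index_kernel (2 * k) i"
proof
  assume bc: "block_constant \<sigma> i"
  show "\<sigma> = index_kernel (2 * k) i"
  proof (rule pairings_refine_imp_eq[OF \<sigma> ker])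
    fix B assume B: "B \<in> \<sigma>"
    have "B \<noteq> {}" using B partition_onD3[OF pairings_partition_on[OF \<sigma>]] by blast
    then obtain s where s: "s \<in> B" by blast
    have "B \<subseteq> fibre (2 * k) i (i s)"
    proof
      fix t assume t: "t \<in> B"
      then have "i t = i s" by (rule block_constantD[OF bc B _ s])
      then show "t \<in> fibre (2 * k) i (i s)"
        using pairing_subset[OF \<sigma> B] t by (auto simp: fibre_def)
    qed
    moreover have "s < 2 * k" using pairing_subset[OF \<sigma> B] s by blast
    ultimately show "\<exists>C\<in>index_kernel (2 * k) i. B \<subseteq> C" by (auto simp: index_kernel_def)
  qed
next
  assume "\<sigma> = index_kernel (2 * k) i"
  then show "block_constant \<sigma> i" by (auto simp: block_constant_def index_kernel_def fibre_def)
qed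

text \<open>The coefficient of \<open>\<pi>\<close> is the value of \<open>T\<close> at an index
  with kernel \<open>\<pi>\<close>; permutation invariance makes the choice of that index
  immaterial. The difference \<open>U\<close> is invariant and vanishes where all multiplicities are
  2, hence everywhere.\<close>

theorem invariant_tensor_span:
  assumes inv: "invariant_tensor (2 * k) n T" and "k \<le> n"
  obtains c where "\<And>i. i \<in> {..<2 * k} \<rightarrow>\<^sub>E {..<n} \<Longrightarrow>
    T i = (\<Sum>\<pi>\<in>pairings k. c \<pi> * of_bool (block_constant \<pi> i))"
proof -
  let ?I = "{..<2 * k} \<rightarrow>\<^sub>E {..<n}"
  \<comment> \<open>The property of the chosen index is used only when \<open>\<pi>\<close> is the
    kernel of a given \<open>i\<close>, and then \<open>i\<close> is a witness.\<close>
  define rep where "rep \<pi> = (SOME i. i \<in> ?I \<and> index_kernel (2 * k) i = \<pi>)" for \<pi>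
  define U where "U i = T i - (\<Sum>\<pi>\<in>pairings k. T (rep \<pi>) * of_bool (block_constant \<pi> i))" for i
  have "invariant_tensor (2 * k) n U"
    unfolding U_def
    by (intro invariant_tensor_diff[OF inv] invariant_tensor_sum invariant_tensor_pairing)
  moreover have "U i = 0" if i: "i \<in> ?I" and two: "\<And>s. s < 2 * k \<Longrightarrow> card (fibre (2 * k) i (i s)) = 2" for i
  proof -
    let ?\<pi> = "index_kernel (2 * k) i"
    have ker: "?\<pi> \<in> pairings k" by (rule index_kernel_pairing[OF two])
    have rep: "rep ?\<pi> \<in> ?I \<and> index_kernel (2 * k) (rep ?\<pi>) = ?\<pi>"
      unfolding rep_def by (rule someI[of _ i]) (simp add: i)
    have "i s = i t \<longleftrightarrow> rep ?\<pi> s = rep ?\<pi> t" if "s < 2 * k" "t < 2 * k" for s t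
      unfolding index_kernel_eq_iff[OF that, of i] index_kernel_eq_iff[OF that, of "rep ?\<pi>"]
      using rep by simp
    then obtain h where h: "bij_betw h {..<n} {..<n}" "rep ?\<pi> = (\<lambda>s\<in>{..<2 * k}. h (i s))"
      using index_permutation[OF i conjunct1[OF rep]] by blast
    have "T i = T (rep ?\<pi>)"
      using invariant_tensor_signed_permutation[OF inv h(1) _ i, of "\<lambda>_. 1"] h(2) by simp
    moreover have "(\<Sum>\<pi>\<in>pairings k. T (rep \<pi>) * of_bool (block_constant \<pi> i)) =
        (\<Sum>\<pi>\<in>pairings k. if \<pi> = ?\<pi> then T (rep ?\<pi>) else 0)"
      by (intro sum.cong refl) (simp add: block_constant_iff_index_kernel[OF _ ker])
    ultimately show ?thesis using ker finite_pairings by (simp add: U_def)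
  qed
  ultimately have "U i = 0" if "i \<in> ?I" for i
    using invariant_tensor_eq_0[OF _ \<open>k \<le> n\<close>] that by blast
  then show ?thesis
    by (intro that[of "\<lambda>\<pi>. T (rep \<pi>)"]) (simp add: U_def)
qed

section \<open>Signed path counts\<close>

lemma brauer_dist_self:
  assumes "\<sigma> \<in> pairings k"
  shows "brauer_dist k \<sigma> \<sigma> = 0"
proof -
  \<comment> \<open>Two labels suffice to read off the exponent: labellings constant on
    \<open>\<sigma>\<close> are counted once by loops and once by blocks.\<close>
  have "real 2 ^ loops k \<sigma> \<sigma> = (\<Sum>l\<in>{..<2 * k} \<rightarrow>\<^sub>E {..<2::nat}. of_bool (block_constant \<sigma> l))"
    using sum_block_constant_pairings[OF assms assms, of 2] by (simp flip: of_bool_conj)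
  also have "\<dots> = real 2 ^ card \<sigma>"
    using sum_block_constant[OF _ pairings_partition_on[OF assms], of "{..<2::nat}" "\<lambda>_ _. 1"] by simp
  finally have "loops k \<sigma> \<sigma> = k"
    by (simp add: card_pairing[OF assms])
  then show ?thesis by (simp add: brauer_dist_def)
qed

lemma path_steps_snoc: "\<tau> \<noteq> [] \<Longrightarrow> path_steps (\<tau> @ [\<sigma>]) = Suc (path_steps \<tau>)"
  by (simp add: path_steps_def)

lemma path_length_snoc:
  assumes "\<tau> \<noteq> []"
  shows "path_length k (\<tau> @ [\<sigma>]) = path_length k \<tau> + brauer_dist k (last \<tau>) \<sigma>"
proof -
  have "path_length k (\<tau> @ [\<sigma>]) =
      (\<Sum>i<path_steps \<tau>. brauer_dist k ((\<tau> @ [\<sigma>]) ! i) ((\<tau> @ [\<sigma>]) ! Suc i)) +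
      brauer_dist k ((\<tau> @ [\<sigma>]) ! path_steps \<tau>) ((\<tau> @ [\<sigma>]) ! Suc (path_steps \<tau>))"
    by (simp add: path_length_def path_steps_snoc[OF assms])
  also have "(\<Sum>i<path_steps \<tau>. brauer_dist k ((\<tau> @ [\<sigma>]) ! i) ((\<tau> @ [\<sigma>]) ! Suc i)) = path_length k \<tau>"
    unfolding path_length_def by (intro sum.cong refl) (auto simp: nth_append path_steps_def)
  also have "(\<tau> @ [\<sigma>]) ! path_steps \<tau> = last \<tau>"
    using assms by (simp add: nth_append path_steps_def last_conv_nth)
  also have "(\<tau> @ [\<sigma>]) ! Suc (path_steps \<tau>) = \<sigma>"
    using assms by (simp add: nth_append path_steps_def)
  finally show ?thesis .
qed

lemma brauer_paths_snoc_iff: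
  assumes "\<tau> \<noteq> []"
  shows "\<tau> @ [\<sigma>] \<in> brauer_paths k \<longleftrightarrow> \<tau> \<in> brauer_paths k \<and> \<sigma> \<in> pairings k \<and> last \<tau> \<noteq> \<sigma>"
  using assms by (auto simp: brauer_paths_def successively_append_iff)

lemma path_steps_le_length:
  assumes \<tau>: "\<tau> \<in> brauer_paths k"
  shows "path_steps \<tau> \<le> path_length k \<tau>"
proof -
  have "(\<Sum>i<path_steps \<tau>. 1) \<le> (\<Sum>i<path_steps \<tau>. brauer_dist k (\<tau> ! i) (\<tau> ! Suc i))"
  proof (rule sum_mono)
    fix i assume "i \<in> {..<path_steps \<tau>}"
    then have i: "Suc i < length \<tau>" by (simp add: path_steps_def)
    have "\<tau> ! i \<in> set \<tau>" "\<tau> ! Suc i \<in> set \<tau>" using i by simp_all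
    then have "\<tau> ! i \<in> pairings k" "\<tau> ! Suc i \<in> pairings k"
      using \<tau> by (auto simp: brauer_paths_def)
    moreover have "\<tau> ! i \<noteq> \<tau> ! Suc i"
      using \<tau> i successively_nth[of "(\<noteq>)" \<tau> i] by (simp add: brauer_paths_def)
    ultimately show "1 \<le> brauer_dist k (\<tau> ! i) (\<tau> ! Suc i)"
      using brauer_dist_pos by (metis One_nat_def Suc_leI)
  qed
  then show ?thesis by (simp add: path_length_def)
qed

lemma finite_brauer_paths_length: "finite {\<tau> \<in> brauer_paths k. path_length k \<tau> = d}"
proof (rule finite_subset)
  show "{\<tau> \<in> brauer_paths k. path_length k \<tau> = d} \<subseteq> {\<tau>. set \<tau> \<subseteq> pairings k \<and> length \<tau> \<le> Suc d}"
  proof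
    fix \<tau> assume "\<tau> \<in> {\<tau> \<in> brauer_paths k. path_length k \<tau> = d}"
    then show "\<tau> \<in> {\<tau>. set \<tau> \<subseteq> pairings k \<and> length \<tau> \<le> Suc d}"
      using path_steps_le_length[of \<tau> k] by (simp add: brauer_paths_def path_steps_def)
  qed
  show "finite {\<tau>. set \<tau> \<subseteq> pairings k \<and> length \<tau> \<le> Suc d}"
    by (rule finite_lists_length_le[OF finite_pairings])
qed

section \<open>Signed paths between fixed end points and their generating functions\<close>

definition paths_between :: "nat \<Rightarrow> nat set set \<Rightarrow> nat set set \<Rightarrow> nat \<Rightarrow> nat set set list set" where
  "paths_between k \<pi> \<sigma> d =
    {\<tau> \<in> brauer_paths k. hd \<tau> = \<pi> \<and> last \<tau> = \<sigma> \<and> path_length k \<tau> = d}"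

definition signed_paths :: "nat \<Rightarrow> nat set set \<Rightarrow> nat set set \<Rightarrow> nat \<Rightarrow> real" where
  "signed_paths k \<pi> \<sigma> d = (\<Sum>\<tau>\<in>paths_between k \<pi> \<sigma> d. (- 1) ^ path_steps \<tau>)"

lemma finite_paths_between: "finite (paths_between k \<pi> \<sigma> d)"
  by (rule finite_subset[OF _ finite_brauer_paths_length[of k d]]) (auto simp: paths_between_def)

text \<open>Deleting the last point leaves either nothing, for the one-point path of length 0, or a
  path to some \<open>\<rho>\<close> other than \<open>\<sigma>\<close>. The guard
  \<open>\<le> d\<close> keeps the truncated subtraction honest.\<close>

lemma paths_between_rec:
  assumes \<sigma>: "\<sigma> \<in> pairings k"
  shows "paths_between k \<pi> \<sigma> d = (if d = 0 \<and> \<pi> = \<sigma> then {[\<sigma>]} else {}) \<union>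
    (\<Union>\<rho>\<in>{\<rho> \<in> pairings k - {\<sigma>}. brauer_dist k \<rho> \<sigma> \<le> d}.
      (\<lambda>\<tau>. \<tau> @ [\<sigma>]) ` paths_between k \<pi> \<rho> (d - brauer_dist k \<rho> \<sigma>))" (is "_ = ?A \<union> ?B")
proof (intro Set.set_eqI iffI)
  fix \<tau>' assume \<tau>': "\<tau>' \<in> paths_between k \<pi> \<sigma> d"
  then have "\<tau>' \<noteq> []" by (auto simp: paths_between_def brauer_paths_def)
  then have snoc: "\<tau>' = butlast \<tau>' @ [\<sigma>]"
    using \<tau>' append_butlast_last_id[of \<tau>'] by (simp add: paths_between_def)
  show "\<tau>' \<in> ?A \<union> ?B"
  proof (cases "butlast \<tau>' = []")
    case True
    then have "\<tau>' = [\<sigma>]" using snoc by simp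
    then show ?thesis using \<tau>' by (simp add: paths_between_def path_length_def path_steps_def)
  next
    case False
    define \<tau> where "\<tau> = butlast \<tau>'"
    have ne: "\<tau> \<noteq> []" and eq: "\<tau>' = \<tau> @ [\<sigma>]" using False snoc by (simp_all add: \<tau>_def)
    have mem: "\<tau> @ [\<sigma>] \<in> brauer_paths k" "hd \<tau> = \<pi>" "path_length k (\<tau> @ [\<sigma>]) = d"
      using \<tau>' ne by (auto simp: paths_between_def eq)
    have \<tau>: "\<tau> \<in> brauer_paths k" "last \<tau> \<noteq> \<sigma>"
      using mem(1) by (simp_all add: brauer_paths_snoc_iff[OF ne])
    have len: "path_length k \<tau> + brauer_dist k (last \<tau>) \<sigma> = d"
      using mem(3) by (simp add: path_length_snoc[OF ne])
    have "last \<tau> \<in> pairings k" using \<tau>(1) ne by (auto simp: brauer_paths_def)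
    moreover have "\<tau> \<in> paths_between k \<pi> (last \<tau>) (d - brauer_dist k (last \<tau>) \<sigma>)"
      using mem \<tau> len by (auto simp: paths_between_def)
    ultimately have "\<tau>' \<in> ?B"
      using \<tau> len by (intro UN_I[of "last \<tau>"] image_eqI[of _ _ \<tau>]) (auto simp: eq)
    then show ?thesis by simp
  qed
next
  fix \<tau>' assume "\<tau>' \<in> ?A \<union> ?B"
  then consider "\<tau>' = [\<sigma>]" "d = 0" "\<pi> = \<sigma>"
    | \<rho> \<tau> where "\<rho> \<in> pairings k" "\<rho> \<noteq> \<sigma>" "brauer_dist k \<rho> \<sigma> \<le> d"
      "\<tau> \<in> paths_between k \<pi> \<rho> (d - brauer_dist k \<rho> \<sigma>)" "\<tau>' = \<tau> @ [\<sigma>]"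
    by (auto split: if_splits)
  then show "\<tau>' \<in> paths_between k \<pi> \<sigma> d"
  proof cases
    case 1
    then show ?thesis
      using \<sigma> by (simp add: paths_between_def brauer_paths_def path_length_def path_steps_def)
  next
    case 2
    then have "\<tau> \<noteq> []" by (auto simp: paths_between_def brauer_paths_def)
    then show ?thesis
      using 2 \<sigma> by (auto simp: paths_between_def brauer_paths_snoc_iff path_length_snoc)
  qed
qed

text \<open>Each deleted step costs a factor -1. This is the coefficientwise form of W = 1 - W Y
  with Y the off-diagonal part of the distance matrix.\<close>

lemma signed_paths_rec:
  assumes \<sigma>: "\<sigma> \<in> pairings k"
  shows "signed_paths k \<pi> \<sigma> d = of_bool (d = 0 \<and> \<pi> = \<sigma>) -
    (\<Sum>\<rho>\<in>pairings k - {\<sigma>}. if brauer_dist k \<rho> \<sigma> \<le> d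
       then signed_paths k \<pi> \<rho> (d - brauer_dist k \<rho> \<sigma>) else 0)"
proof -
  let ?A = "if d = 0 \<and> \<pi> = \<sigma> then {[\<sigma>]} else {}"
  let ?R = "{\<rho> \<in> pairings k - {\<sigma>}. brauer_dist k \<rho> \<sigma> \<le> d}"
  let ?B = "\<lambda>\<rho>. (\<lambda>\<tau>. \<tau> @ [\<sigma>]) ` paths_between k \<pi> \<rho> (d - brauer_dist k \<rho> \<sigma>)"
  have ne: "\<tau> \<noteq> []" if "\<tau> \<in> paths_between k \<pi> \<rho> e" for \<tau> \<rho> e
    using that by (auto simp: paths_between_def brauer_paths_def)
  have finR: "finite ?R" using finite_pairings by simp
  have finB: "finite (?B \<rho>)" for \<rho> by (intro finite_imageI finite_paths_between)
  have "signed_paths k \<pi> \<sigma> d =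
      (\<Sum>\<tau>\<in>?A. (- 1) ^ path_steps \<tau>) + (\<Sum>\<tau>\<in>(\<Union>\<rho>\<in>?R. ?B \<rho>). (- 1) ^ path_steps \<tau>)"
    unfolding signed_paths_def paths_between_rec[OF \<sigma>, of \<pi> d]
  proof (rule sum.union_disjoint)
    show "finite ?A" by simp
    show "finite (\<Union>\<rho>\<in>?R. ?B \<rho>)" using finR finB by blast
    \<comment> \<open>Paths are nonempty, so an extended path has at least two points and differs
      from \<open>[\<sigma>]\<close>.\<close>
    have "[] \<notin> paths_between k \<pi> \<rho> e" for \<rho> e using ne by blast
    then show "?A \<inter> (\<Union>\<rho>\<in>?R. ?B \<rho>) = {}" by auto
  qed
  also have "(\<Sum>\<tau>\<in>?A. (- 1) ^ path_steps \<tau>) = (of_bool (d = 0 \<and> \<pi> = \<sigma>) :: real)"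
    by (simp add: path_steps_def)
  also have "(\<Sum>\<tau>\<in>(\<Union>\<rho>\<in>?R. ?B \<rho>). (- 1) ^ path_steps \<tau>) =
      (\<Sum>\<rho>\<in>?R. \<Sum>\<tau>\<in>?B \<rho>. (- 1) ^ path_steps \<tau> :: real)"
    \<comment> \<open>Disjointness holds because \<open>\<rho>\<close> is the last point of the
      truncated path.\<close>
    using finR finB by (intro sum.UNION_disjoint) (auto simp: paths_between_def)
  also have "\<dots> = (\<Sum>\<rho>\<in>?R. - signed_paths k \<pi> \<rho> (d - brauer_dist k \<rho> \<sigma>))"
  proof (intro sum.cong refl)
    fix \<rho>
    have "(\<Sum>\<tau>\<in>?B \<rho>. (- 1) ^ path_steps \<tau> :: real) =
        (\<Sum>\<tau>\<in>paths_between k \<pi> \<rho> (d - brauer_dist k \<rho> \<sigma>). (- 1) ^ path_steps (\<tau> @ [\<sigma>]))"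
      by (subst sum.reindex) (auto simp: inj_on_def)
    also have "\<dots> = (\<Sum>\<tau>\<in>paths_between k \<pi> \<rho> (d - brauer_dist k \<rho> \<sigma>). - ((- 1) ^ path_steps \<tau>))"
      by (intro sum.cong refl) (simp add: path_steps_snoc[OF ne])
    finally show "(\<Sum>\<tau>\<in>?B \<rho>. (- 1) ^ path_steps \<tau> :: real) =
        - signed_paths k \<pi> \<rho> (d - brauer_dist k \<rho> \<sigma>)"
      by (simp add: signed_paths_def sum_negf)
  qed
  also have "\<dots> = - (\<Sum>\<rho>\<in>pairings k - {\<sigma>}. if brauer_dist k \<rho> \<sigma> \<le> d
       then signed_paths k \<pi> \<rho> (d - brauer_dist k \<rho> \<sigma>) else 0)"
    unfolding sum_negf by (subst sum.inter_filter) (use finite_pairings in auto)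
  finally show ?thesis by simp
qed

text \<open>The last step has length at least 1 and fewer than |D_k| possible starting points. The
  recursion therefore gains at most one factor |D_k| each time \<open>d\<close> drops by at least
  1.\<close>

lemma abs_signed_paths_le:
  "\<sigma> \<in> pairings k \<Longrightarrow> \<bar>signed_paths k \<pi> \<sigma> d\<bar> \<le> real (card (pairings k)) ^ d"
proof (induction d arbitrary: \<sigma> rule: less_induct)
  case (less d)
  let ?P = "pairings k" and ?M = "real (card (pairings k))"
  have dist: "0 < brauer_dist k \<rho> \<sigma>" if "\<rho> \<in> ?P - {\<sigma>}" for \<rho>
    using brauer_dist_pos that less.prems by blast
  show ?case
  proof (cases "d = 0")
    case True
    have "(\<Sum>\<rho>\<in>?P - {\<sigma>}. if brauer_dist k \<rho> \<sigma> \<le> d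
       then signed_paths k \<pi> \<rho> (d - brauer_dist k \<rho> \<sigma>) else 0) = 0"
    proof (intro sum.neutral ballI)
      fix \<rho> assume "\<rho> \<in> ?P - {\<sigma>}"
      then show "(if brauer_dist k \<rho> \<sigma> \<le> d
          then signed_paths k \<pi> \<rho> (d - brauer_dist k \<rho> \<sigma>) else 0) = 0"
        using dist[of \<rho>] True by simp
    qed
    then show ?thesis using True signed_paths_rec[OF less.prems, of \<pi> d] by simp
  next
    case False
    have M1: "1 \<le> ?M"
      using less.prems finite_pairings[of k] by (metis One_nat_def Suc_leI card_gt_0_iff empty_iff of_nat_1 of_nat_mono)
    have "\<bar>signed_paths k \<pi> \<sigma> d\<bar> = \<bar>\<Sum>\<rho>\<in>?P - {\<sigma>}. if brauer_dist k \<rho> \<sigma> \<le> d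
       then signed_paths k \<pi> \<rho> (d - brauer_dist k \<rho> \<sigma>) else 0\<bar>"
      using False signed_paths_rec[OF less.prems, of \<pi> d] by simp
    also have "\<dots> \<le> (\<Sum>\<rho>\<in>?P - {\<sigma>}. \<bar>if brauer_dist k \<rho> \<sigma> \<le> d
       then signed_paths k \<pi> \<rho> (d - brauer_dist k \<rho> \<sigma>) else 0\<bar>)"
      by (rule sum_abs)
    also have "\<dots> \<le> (\<Sum>\<rho>\<in>?P - {\<sigma>}. ?M ^ (d - 1))"
    proof (rule sum_mono)
      fix \<rho> assume \<rho>: "\<rho> \<in> ?P - {\<sigma>}"
      show "\<bar>if brauer_dist k \<rho> \<sigma> \<le> d
         then signed_paths k \<pi> \<rho> (d - brauer_dist k \<rho> \<sigma>) else 0\<bar> \<le> ?M ^ (d - 1)"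
      proof (cases "brauer_dist k \<rho> \<sigma> \<le> d")
        case True
        have "\<bar>signed_paths k \<pi> \<rho> (d - brauer_dist k \<rho> \<sigma>)\<bar> \<le> ?M ^ (d - brauer_dist k \<rho> \<sigma>)"
          using \<rho> dist[OF \<rho>] False by (intro less.IH) auto
        also have "\<dots> \<le> ?M ^ (d - 1)"
          using dist[OF \<rho>] M1 by (intro power_increasing) auto
        finally show ?thesis using True by simp
      qed simp
    qed
    also have "\<dots> = real (card (?P - {\<sigma>})) * ?M ^ (d - 1)" by simp
    also have "\<dots> \<le> ?M * ?M ^ (d - 1)"
      using finite_pairings by (intro mult_right_mono) (auto intro: card_mono)
    also have "\<dots> = ?M ^ d" using False by (cases d) auto
    finally show ?thesis .
  qed
qed

lemma summable_signed_paths: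
  assumes "\<sigma> \<in> pairings k" "card (pairings k) < n"
  shows "summable (\<lambda>d. signed_paths k \<pi> \<sigma> d * (1 / real n) ^ d)"
proof (rule summable_comparison_test')
  let ?q = "real (card (pairings k)) / real n"
  show "summable (\<lambda>d. ?q ^ d)" using assms by (intro summable_geometric) simp
  show "norm (signed_paths k \<pi> \<sigma> d * (1 / real n) ^ d) \<le> ?q ^ d" for d
    using abs_signed_paths_le[OF assms(1), of \<pi> d]
    by (simp add: abs_mult power_divide divide_right_mono)
qed

definition path_series :: "nat \<Rightarrow> nat \<Rightarrow> nat set set \<Rightarrow> nat set set \<Rightarrow> real" where
  "path_series k n \<pi> \<sigma> = (\<Sum>d. signed_paths k \<pi> \<sigma> d * (1 / real n) ^ d)"

lemma sums_shift_power:
  fixes f :: "nat \<Rightarrow> real"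
  assumes "(\<lambda>d. f d * x ^ d) sums s"
  shows "(\<lambda>d. (if e \<le> d then f (d - e) else 0) * x ^ d) sums (x ^ e * s)"
proof -
  have "(\<lambda>d. (if e \<le> d + e then f (d + e - e) else 0) * x ^ (d + e)) = (\<lambda>d. x ^ e * (f d * x ^ d))"
    by (simp add: power_add mult_ac)
  then have "(\<lambda>d. (if e \<le> d + e then f (d + e - e) else 0) * x ^ (d + e)) sums (x ^ e * s)"
    using sums_mult[OF assms, of "x ^ e"] by simp
  then show ?thesis
    by (subst (asm) sums_iff_shift) simp
qed

text \<open>Multiplying the recursion by n^(-d) and summing turns the shift by a distance into a
  factor n^(-distance), giving W = 1 - W Y. As the diagonal distances are 0, this says W (1 + Y) =
  1.\<close>

lemma path_series_inverse:
  assumes n: "card (pairings k) < n" and \<sigma>: "\<sigma> \<in> pairings k"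
  shows "(\<Sum>\<rho>\<in>pairings k. path_series k n \<pi> \<rho> * (1 / real n) ^ brauer_dist k \<rho> \<sigma>) = of_bool (\<pi> = \<sigma>)"
proof -
  let ?P = "pairings k" and ?x = "1 / real n"
  have S: "(\<lambda>d. signed_paths k \<pi> \<rho> d * ?x ^ d) sums path_series k n \<pi> \<rho>" if "\<rho> \<in> ?P" for \<rho>
    unfolding path_series_def by (rule summable_sums[OF summable_signed_paths[OF that n]])
  have "(\<lambda>d. of_bool (\<pi> = \<sigma>) * (if d = 0 then 1 else 0) -
      (\<Sum>\<rho>\<in>?P - {\<sigma>}. (if brauer_dist k \<rho> \<sigma> \<le> d
       then signed_paths k \<pi> \<rho> (d - brauer_dist k \<rho> \<sigma>) else 0) * ?x ^ d))
    sums (of_bool (\<pi> = \<sigma>) * 1 - (\<Sum>\<rho>\<in>?P - {\<sigma>}. ?x ^ brauer_dist k \<rho> \<sigma> * path_series k n \<pi> \<rho>))"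
    by (intro sums_diff sums_mult sums_single sums_sum sums_shift_power S) auto
  also have "(\<lambda>d. of_bool (\<pi> = \<sigma>) * (if d = 0 then 1 else 0) -
      (\<Sum>\<rho>\<in>?P - {\<sigma>}. (if brauer_dist k \<rho> \<sigma> \<le> d
       then signed_paths k \<pi> \<rho> (d - brauer_dist k \<rho> \<sigma>) else 0) * ?x ^ d)) =
      (\<lambda>d. signed_paths k \<pi> \<sigma> d * ?x ^ d)"
    by (rule ext, subst signed_paths_rec[OF \<sigma>])
      (auto simp: sum_distrib_right left_diff_distrib)
  finally have "path_series k n \<pi> \<sigma> =
      of_bool (\<pi> = \<sigma>) * 1 - (\<Sum>\<rho>\<in>?P - {\<sigma>}. ?x ^ brauer_dist k \<rho> \<sigma> * path_series k n \<pi> \<rho>)"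
    by (rule sums_unique2[OF S[OF \<sigma>]])
  moreover have "(\<Sum>\<rho>\<in>?P. path_series k n \<pi> \<rho> * ?x ^ brauer_dist k \<rho> \<sigma>) =
      path_series k n \<pi> \<sigma> * ?x ^ brauer_dist k \<sigma> \<sigma> +
      (\<Sum>\<rho>\<in>?P - {\<sigma>}. path_series k n \<pi> \<rho> * ?x ^ brauer_dist k \<rho> \<sigma>)"
    by (rule sum.remove[OF finite_pairings \<sigma>])
  ultimately show ?thesis by (simp add: brauer_dist_self[OF \<sigma>] mult.commute)
qed

lemma signed_count_eq:
  "real_of_int (signed_count k a d) =
    (\<Sum>\<pi>\<in>{\<pi> \<in> pairings k. pairing_delta \<pi> (left_index a)}.
      \<Sum>\<sigma>\<in>{\<sigma> \<in> pairings k. pairing_delta \<sigma> (right_index a)}. signed_paths k \<pi> \<sigma> d)"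
proof -
  let ?A = "admissible_paths k a d"
  let ?L = "{\<pi> \<in> pairings k. pairing_delta \<pi> (left_index a)}"
  let ?R = "{\<sigma> \<in> pairings k. pairing_delta \<sigma> (right_index a)}"
  have fin: "finite ?A"
    by (rule finite_subset[OF _ finite_brauer_paths_length[of k d]]) (auto simp: admissible_paths_def)
  have ends: "hd \<tau> \<in> pairings k" "last \<tau> \<in> pairings k" if "\<tau> \<in> brauer_paths k" for \<tau>
    using that by (auto simp: brauer_paths_def)
  have "(\<Sum>\<tau>\<in>?A. (- 1) ^ path_steps \<tau> :: real) = (\<Sum>\<tau>\<in>?A. if even (path_steps \<tau>) then 1 else - 1)"
    by (intro sum.cong) auto
  also have "\<dots> = real (card {\<tau> \<in> ?A. even (path_steps \<tau>)}) - real (card {\<tau> \<in> ?A. odd (path_steps \<tau>)})"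
    using fin by (simp add: sum.If_cases Int_def)
  finally have "real_of_int (signed_count k a d) = (\<Sum>\<tau>\<in>?A. (- 1) ^ path_steps \<tau>)"
    by (simp add: signed_count_def)
  also have "\<dots> = (\<Sum>\<pi>\<sigma>\<in>?L \<times> ?R. \<Sum>\<tau>\<in>{\<tau> \<in> ?A. (hd \<tau>, last \<tau>) = \<pi>\<sigma>}. (- 1) ^ path_steps \<tau>)"
    using fin finite_pairings ends
    by (intro sum.group[symmetric]) (auto simp: admissible_paths_def)
  also have "\<dots> = (\<Sum>(\<pi>, \<sigma>)\<in>?L \<times> ?R. signed_paths k \<pi> \<sigma> d)"
    unfolding signed_paths_def
    by (intro sum.cong refl) (auto simp: admissible_paths_def paths_between_def intro!: sum.cong)
  finally show ?thesis by (simp add: sum.cartesian_product)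
qed

lemma signed_count_sums:
  assumes "card (pairings k) < n"
  shows "(\<lambda>d. real_of_int (signed_count k a d) / real n ^ d) sums
    (\<Sum>\<pi>\<in>{\<pi> \<in> pairings k. pairing_delta \<pi> (left_index a)}.
      \<Sum>\<sigma>\<in>{\<sigma> \<in> pairings k. pairing_delta \<sigma> (right_index a)}. path_series k n \<pi> \<sigma>)"
proof -
  have "(\<lambda>d. \<Sum>\<pi>\<in>{\<pi> \<in> pairings k. pairing_delta \<pi> (left_index a)}.
      \<Sum>\<sigma>\<in>{\<sigma> \<in> pairings k. pairing_delta \<sigma> (right_index a)}. signed_paths k \<pi> \<sigma> d * (1 / real n) ^ d) sums
    (\<Sum>\<pi>\<in>{\<pi> \<in> pairings k. pairing_delta \<pi> (left_index a)}.
      \<Sum>\<sigma>\<in>{\<sigma> \<in> pairings k. pairing_delta \<sigma> (right_index a)}. path_series k n \<pi> \<sigma>)"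
    unfolding path_series_def
    by (intro sums_sum summable_sums summable_signed_paths[OF _ assms]) simp
  then show ?thesis
    by (simp add: signed_count_eq sum_divide_distrib power_one_over field_simps)
qed

section \<open>Moments of the Haar measure\<close>

text \<open>Contracting a combination of delta tensors with each delta tensor gives
  \<open>\<beta>\<close> as the Gram matrix applied to the coefficients. By
  \<open>power_loops\<close> the Gram matrix is n^k times the matrix of n^(-distance), so
  \<open>path_series\<close> divided by n^k is a left inverse and solves for them.\<close>

lemma invariant_tensor_eq_path_series:
  assumes inv: "invariant_tensor (2 * k) n T" and n: "k \<le> n" "card (pairings k) < n"
    and \<beta>: "\<And>\<rho>. \<rho> \<in> pairings k \<Longrightarrow>
      (\<Sum>l\<in>{..<2 * k} \<rightarrow>\<^sub>E {..<n}. of_bool (block_constant \<rho> l) * T l) = \<beta> \<rho>"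
    and i: "i \<in> {..<2 * k} \<rightarrow>\<^sub>E {..<n}"
  shows "T i = 1 / real n ^ k * (\<Sum>\<pi>\<in>pairings k. of_bool (block_constant \<pi> i) *
    (\<Sum>\<rho>\<in>pairings k. path_series k n \<pi> \<rho> * \<beta> \<rho>))"
proof -
  let ?P = "pairings k" and ?I = "{..<2 * k} \<rightarrow>\<^sub>E {..<n}" and ?x = "1 / real n"
  obtain c where c: "\<And>i. i \<in> ?I \<Longrightarrow> T i = (\<Sum>\<pi>\<in>?P. c \<pi> * of_bool (block_constant \<pi> i))"
    using invariant_tensor_span[OF inv n(1)] by blast
  have n0: "n > 0" using n by simp
  have \<beta>': "\<beta> \<rho> = real n ^ k * (\<Sum>\<sigma>\<in>?P. ?x ^ brauer_dist k \<rho> \<sigma> * c \<sigma>)" if \<rho>: "\<rho> \<in> ?P" for \<rho>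
  proof -
    have "\<beta> \<rho> = (\<Sum>l\<in>?I. of_bool (block_constant \<rho> l) * (\<Sum>\<sigma>\<in>?P. c \<sigma> * of_bool (block_constant \<sigma> l)))"
      unfolding \<beta>[OF \<rho>, symmetric] by (intro sum.cong refl) (simp only: c)
    also have "\<dots> = (\<Sum>\<sigma>\<in>?P. c \<sigma> * (\<Sum>l\<in>?I. of_bool (block_constant \<rho> l) * of_bool (block_constant \<sigma> l)))"
      unfolding sum_distrib_left by (subst sum.swap) (intro sum.cong refl mult.left_commute)
    also have "\<dots> = (\<Sum>\<sigma>\<in>?P. c \<sigma> * (real n ^ k * ?x ^ brauer_dist k \<rho> \<sigma>))"
      by (intro sum.cong refl)
        (simp only: sum_block_constant_pairings[OF \<rho>] power_loops[OF \<rho> _ n0] divide_inverse mult_1 power_inverse)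
    finally show ?thesis by (simp add: sum_distrib_left mult_ac)
  qed
  have c_eq: "c \<pi> = ?x ^ k * (\<Sum>\<rho>\<in>?P. path_series k n \<pi> \<rho> * \<beta> \<rho>)" if \<pi>: "\<pi> \<in> ?P" for \<pi>
  proof -
    have "(\<Sum>\<sigma>\<in>?P. of_bool (\<pi> = \<sigma>) * c \<sigma>) = (\<Sum>\<sigma>\<in>?P. if \<sigma> = \<pi> then c \<sigma> else 0)"
      by (intro sum.cong) auto
    then have "c \<pi> = (\<Sum>\<sigma>\<in>?P. of_bool (\<pi> = \<sigma>) * c \<sigma>)"
      using \<pi> finite_pairings by simp
    also have "\<dots> = (\<Sum>\<sigma>\<in>?P. (\<Sum>\<rho>\<in>?P. path_series k n \<pi> \<rho> * ?x ^ brauer_dist k \<rho> \<sigma>) * c \<sigma>)"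
      by (intro sum.cong refl) (simp only: path_series_inverse[OF n(2)])
    also have "\<dots> = (\<Sum>\<rho>\<in>?P. path_series k n \<pi> \<rho> * (\<Sum>\<sigma>\<in>?P. ?x ^ brauer_dist k \<rho> \<sigma> * c \<sigma>))"
      unfolding sum_distrib_left sum_distrib_right by (subst sum.swap) (simp only: mult.assoc)
    also have "\<dots> = (\<Sum>\<rho>\<in>?P. path_series k n \<pi> \<rho> * (?x ^ k * \<beta> \<rho>))"
      using n0 by (intro sum.cong refl) (simp add: \<beta>' power_one_over)
    finally show ?thesis by (simp add: sum_distrib_left mult_ac)
  qed
  have "T i = (\<Sum>\<pi>\<in>?P. ?x ^ k * (of_bool (block_constant \<pi> i) * (\<Sum>\<rho>\<in>?P. path_series k n \<pi> \<rho> * \<beta> \<rho>)))"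
    unfolding c[OF i] by (intro sum.cong refl) (simp add: c_eq)
  then show ?thesis by (simp only: sum_distrib_left power_one_over)
qed

section \<open>Orthogonal matrices in terms of their entries\<close>

lemma orthogonal_group_rows:
  assumes "u \<in> orthogonal_group n" "i < n" "j < n"
  shows "(\<Sum>v<n. u $$ (i, v) * u $$ (j, v)) = of_bool (i = j)"
proof -
  have u: "u \<in> carrier_mat n n" "u * transpose_mat u = 1\<^sub>m n"
    using assms by (simp_all add: orthogonal_group_def)
  have "(u * transpose_mat u) $$ (i, j) = (\<Sum>v<n. u $$ (i, v) * u $$ (j, v))"
    using u(1) assms by (simp add: scalar_prod_def atLeast0LessThan)
  then show ?thesis using assms by (auto simp: u(2))
qed

lemma orthogonal_group_cols:
  assumes "u \<in> orthogonal_group n" "i < n" "j < n"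
  shows "(\<Sum>v<n. u $$ (v, i) * u $$ (v, j)) = of_bool (i = j)"
proof -
  have u: "u \<in> carrier_mat n n" "transpose_mat u * u = 1\<^sub>m n"
    using assms by (simp_all add: orthogonal_group_def)
  have "(transpose_mat u * u) $$ (i, j) = (\<Sum>v<n. u $$ (v, i) * u $$ (v, j))"
    using u(1) assms by (simp add: scalar_prod_def atLeast0LessThan)
  then show ?thesis using assms by (auto simp: u(2))
qed

lemma orthogonal_group_entry_le_1:
  assumes "u \<in> orthogonal_group n" "i < n" "j < n"
  shows "\<bar>u $$ (i, j)\<bar> \<le> 1"
proof -
  have "u $$ (i, j) * u $$ (i, j) \<le> (\<Sum>v<n. u $$ (i, v) * u $$ (i, v))"
    using assms by (intro member_le_sum[of j "{..<n}" "\<lambda>v. u $$ (i, v) * u $$ (i, v)"]) auto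
  also have "\<dots> = 1" using orthogonal_group_rows[OF assms(1,2,2)] by simp
  finally have "(u $$ (i, j))\<^sup>2 \<le> 1" by (simp add: power2_eq_square)
  then show ?thesis by (simp add: abs_square_le_1)
qed

lemma orthonormal_rows_imp_orthogonal_group:
  assumes "orthonormal_rows n g"
  shows "mat n n (\<lambda>(i, j). g i j) \<in> orthogonal_group n"
proof -
  let ?G = "mat n n (\<lambda>(i, j). g i j)"
  have "?G * transpose_mat ?G = 1\<^sub>m n"
    using assms by (intro eq_matI)
      (auto simp: scalar_prod_def orthonormal_rows_def atLeast0LessThan)
  moreover have "transpose_mat ?G * ?G = 1\<^sub>m n"
    by (rule mat_mult_left_right_inverse[OF _ _ calculation]) auto
  ultimately show ?thesis by (simp add: orthogonal_group_def)
qed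

lemma orthogonal_group_mult:
  assumes "g \<in> orthogonal_group n" "u \<in> orthogonal_group n"
  shows "g * u \<in> orthogonal_group n"
proof -
  have g: "g \<in> carrier_mat n n" "g * transpose_mat g = 1\<^sub>m n"
    and u: "u \<in> carrier_mat n n" "u * transpose_mat u = 1\<^sub>m n"
    using assms by (simp_all add: orthogonal_group_def)
  have gu: "g * u \<in> carrier_mat n n" using g(1) u(1) by (rule mult_carrier_mat)
  have "(g * u) * transpose_mat (g * u) = g * u * (transpose_mat u * transpose_mat g)"
    using transpose_mult[OF g(1) u(1)] by simp
  also have "\<dots> = g * (u * transpose_mat u) * transpose_mat g"
    using g(1) u(1) by (simp add: assoc_mult_mat[of _ n n _ n _ n])
  also have "\<dots> = 1\<^sub>m n" using g u by simp
  finally have "(g * u) * transpose_mat (g * u) = 1\<^sub>m n" .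
  moreover from this have "transpose_mat (g * u) * (g * u) = 1\<^sub>m n"
    by (intro mat_mult_left_right_inverse[OF gu]) (use gu in auto)
  ultimately show ?thesis using gu by (simp add: orthogonal_group_def)
qed

lemma orthogonal_group_transpose: "g \<in> orthogonal_group n \<Longrightarrow> transpose_mat g \<in> orthogonal_group n"
  by (simp add: orthogonal_group_def)

section \<open>Invariance and contractions of the Haar moments\<close>

definition entry_moment :: "real mat measure \<Rightarrow> nat \<Rightarrow> (nat \<Rightarrow> nat) \<Rightarrow> (nat \<Rightarrow> nat) \<Rightarrow> real" where
  "entry_moment M m i j = (LINT u|M. (\<Prod>s<m. u $$ (i s, j s)))"

context
  fixes n :: nat and M :: "real mat measure"
  assumes haar: "is_orthogonal_haar n M"
begin

lemma haar_prob_space: "prob_space M"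
  and space_haar: "space M = orthogonal_group n"
  and sets_haar: "sets M = sets (orthogonal_borel n)"
  using haar by (simp_all add: is_orthogonal_haar_def)

lemma measurable_entry:
  assumes "i < n" "j < n"
  shows "(\<lambda>u. u $$ (i, j)) \<in> borel_measurable M"
proof -
  let ?E = "\<lambda>u. \<lambda>(i, j)\<in>{..<n} \<times> {..<n}. u $$ (i, j)"
  have "?E \<in> measurable M (Pi\<^sub>M ({..<n} \<times> {..<n}) (\<lambda>_. borel :: real measure))"
    unfolding measurable_cong_sets[OF sets_haar refl] orthogonal_borel_def
    by (rule measurable_vimage_algebra1) (auto simp: space_PiM)
  then have "(\<lambda>u. ?E u (i, j)) \<in> borel_measurable M"
    by (rule measurable_compose) (use assms in \<open>auto intro!: measurable_component_singleton\<close>)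
  then show ?thesis using assms by simp
qed

lemma entry_mult:
  assumes "g \<in> orthogonal_group n" "u \<in> orthogonal_group n" "i < n" "j < n"
  shows "(g * u) $$ (i, j) = (\<Sum>v<n. g $$ (i, v) * u $$ (v, j))"
proof -
  have "g \<in> carrier_mat n n" "u \<in> carrier_mat n n"
    using assms by (simp_all add: orthogonal_group_def)
  then show ?thesis using assms by (simp add: scalar_prod_def atLeast0LessThan)
qed

lemma measurable_left_mult:
  assumes g: "g \<in> orthogonal_group n"
  shows "(\<lambda>u. g * u) \<in> measurable M M"
  unfolding measurable_cong_sets[OF refl sets_haar] orthogonal_borel_def
proof (rule measurable_vimage_algebra2)
  show "(\<lambda>u. g * u) \<in> space M \<rightarrow> orthogonal_group n"
    using g by (auto simp: space_haar orthogonal_group_mult)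
  have entry: "(\<lambda>u. (g * u) $$ (i, j)) \<in> borel_measurable M" if "i < n" "j < n" for i j
  proof -
    have "(\<lambda>u. \<Sum>v<n. g $$ (i, v) * u $$ (v, j)) \<in> borel_measurable M"
      using that by (intro borel_measurable_sum borel_measurable_times borel_measurable_const measurable_entry) auto
    then show ?thesis
      using entry_mult[OF g] that by (subst measurable_cong) (auto simp: space_haar)
  qed
  show "(\<lambda>u. \<lambda>(i, j)\<in>{..<n} \<times> {..<n}. (g * u) $$ (i, j)) \<in>
      measurable M (Pi\<^sub>M ({..<n} \<times> {..<n}) (\<lambda>_. borel))"
    by (rule measurable_restrict) (use entry in auto)
qed

text \<open>Haar invariance is stated for images, the push-forward for preimages. The two agree
  since translation by \<open>g\<close> maps the preimage of \<open>A\<close> onto \<open>A\<close>,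
  with transpose of \<open>g\<close> as inverse.\<close>

lemma distr_left_mult:
  assumes g: "g \<in> orthogonal_group n"
  shows "distr M M (\<lambda>u. g * u) = M"
proof (rule measure_eqI)
  fix A assume "A \<in> sets (distr M M (\<lambda>u. g * u))"
  then have A: "A \<in> sets M" by simp
  define B where "B = (\<lambda>u. g * u) -` A \<inter> space M"
  have B: "B \<in> sets M" unfolding B_def by (rule measurable_sets[OF measurable_left_mult[OF g] A])
  have "(\<lambda>u. g * u) ` B = A"
  proof (intro equalityI subsetI)
    fix u assume u: "u \<in> A"
    then have uM: "u \<in> orthogonal_group n" using sets.sets_into_space[OF A] by (auto simp: space_haar)
    have "g * (transpose_mat g * u) = g * transpose_mat g * u"
      using g uM by (intro assoc_mult_mat[symmetric, of _ n n _ n _ n]) (auto simp: orthogonal_group_def)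
    also have "\<dots> = u" using g uM by (auto simp: orthogonal_group_def)
    finally have gu: "g * (transpose_mat g * u) = u" .
    then have "transpose_mat g * u \<in> B"
      using u uM g by (simp add: B_def space_haar orthogonal_group_mult orthogonal_group_transpose)
    with gu show "u \<in> (\<lambda>u. g * u) ` B" by (metis image_eqI)
  qed (auto simp: B_def)
  then have "emeasure M A = emeasure M B"
    using haar g B by (force simp: is_orthogonal_haar_def)
  then show "emeasure (distr M M (\<lambda>u. g * u)) A = emeasure M A"
    using emeasure_distr[OF measurable_left_mult[OF g] A] by (simp add: B_def)
qed simp

lemma measurable_entry_prod:
  assumes "i \<in> {..<m} \<rightarrow>\<^sub>E {..<n}" "j \<in> {..<m} \<rightarrow>\<^sub>E {..<n}"
  shows "(\<lambda>u. \<Prod>s<m. u $$ (i s, j s)) \<in> borel_measurable M"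
  using PiE_mem[OF assms(1)] PiE_mem[OF assms(2)]
  by (intro borel_measurable_prod measurable_entry) auto

lemma integrable_entry_prod:
  assumes "i \<in> {..<m} \<rightarrow>\<^sub>E {..<n}" "j \<in> {..<m} \<rightarrow>\<^sub>E {..<n}"
  shows "integrable M (\<lambda>u. \<Prod>s<m. u $$ (i s, j s))"
proof (rule finite_measure.integrable_const_bound[where B = 1])
  show "finite_measure M" using haar_prob_space by (simp add: prob_space_def)
  show "AE u in M. norm (\<Prod>s<m. u $$ (i s, j s)) \<le> 1"
  proof (rule AE_I2)
    fix u assume "u \<in> space M"
    then have "\<bar>u $$ (i s, j s)\<bar> \<le> 1" if "s < m" for s
      using orthogonal_group_entry_le_1 PiE_mem[OF assms(1), of s] PiE_mem[OF assms(2), of s] that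
      by (simp add: space_haar)
    then show "norm (\<Prod>s<m. u $$ (i s, j s)) \<le> 1"
      unfolding real_norm_def abs_prod by (intro prod_le_1) auto
  qed
qed (rule measurable_entry_prod[OF assms])

text \<open>Replace u by G u in the integral, expand the product of row sums into a sum over
  multi-indices \<open>l\<close>, and integrate termwise; entries are bounded by 1, so everything is
  integrable.\<close>

lemma invariant_tensor_entry_moment:
  assumes j: "j \<in> {..<m} \<rightarrow>\<^sub>E {..<n}"
  shows "invariant_tensor m n (\<lambda>i. entry_moment M m i j)"
  unfolding invariant_tensor_def
proof (intro allI impI ballI)
  fix g i assume g: "orthonormal_rows n g" and i: "i \<in> {..<m} \<rightarrow>\<^sub>E {..<n}"
  let ?I = "{..<m} \<rightarrow>\<^sub>E {..<n}"
  define G where "G = mat n n (\<lambda>(i, j). g i j)"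
  have G: "G \<in> orthogonal_group n"
    unfolding G_def by (rule orthonormal_rows_imp_orthogonal_group[OF g])
  have ij: "i s < n" "j s < n" if "s < m" for s
    using PiE_mem[OF i, of s] PiE_mem[OF j, of s] that by auto
  have "entry_moment M m i j = (LINT u|distr M M (\<lambda>u. G * u). (\<Prod>s<m. u $$ (i s, j s)))"
    by (simp add: distr_left_mult[OF G] entry_moment_def)
  also have "\<dots> = (LINT u|M. (\<Prod>s<m. (G * u) $$ (i s, j s)))"
    by (rule integral_distr[OF measurable_left_mult[OF G] measurable_entry_prod[OF i j]])
  also have "\<dots> = (LINT u|M. (\<Sum>l\<in>?I. (\<Prod>s<m. g (i s) (l s)) * (\<Prod>s<m. u $$ (l s, j s))))"
  proof (rule Bochner_Integration.integral_cong[OF refl])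
    fix u assume u: "u \<in> space M"
    have "(\<Prod>s<m. (G * u) $$ (i s, j s)) = (\<Prod>s<m. \<Sum>v<n. g (i s) v * u $$ (v, j s))"
    proof (intro prod.cong refl)
      fix s assume s: "s \<in> {..<m}"
      have "(G * u) $$ (i s, j s) = (\<Sum>v<n. G $$ (i s, v) * u $$ (v, j s))"
        using G u ij s by (intro entry_mult) (auto simp: space_haar)
      then show "(G * u) $$ (i s, j s) = (\<Sum>v<n. g (i s) v * u $$ (v, j s))"
        using ij s by (simp add: G_def)
    qed
    also have "\<dots> = (\<Sum>l\<in>?I. \<Prod>s<m. g (i s) (l s) * u $$ (l s, j s))"
      by (rule prod_sum_PiE) auto
    finally show "(\<Prod>s<m. (G * u) $$ (i s, j s)) =
        (\<Sum>l\<in>?I. (\<Prod>s<m. g (i s) (l s)) * (\<Prod>s<m. u $$ (l s, j s)))"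
      by (simp add: prod.distrib)
  qed
  also have "\<dots> = (\<Sum>l\<in>?I. (\<Prod>s<m. g (i s) (l s)) * entry_moment M m l j)"
    unfolding entry_moment_def
    by (subst Bochner_Integration.integral_sum) (auto intro!: integrable_mult_right integrable_entry_prod j)
  finally show "(\<Sum>l\<in>?I. (\<Prod>s<m. g (i s) (l s)) * entry_moment M m l j) = entry_moment M m i j" by simp
qed

text \<open>The contraction is already constant in u, because the columns of each orthogonal matrix
  are orthonormal; integrating over a probability measure keeps the value.\<close>

lemma sum_pairing_entry_moment:
  assumes \<rho>: "\<rho> \<in> pairings k" and j: "j \<in> {..<2 * k} \<rightarrow>\<^sub>E {..<n}"
  shows "(\<Sum>l\<in>{..<2 * k} \<rightarrow>\<^sub>E {..<n}. of_bool (block_constant \<rho> l) * entry_moment M (2 * k) l j) =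
    of_bool (block_constant \<rho> j)"
proof -
  interpret prob_space M by (rule haar_prob_space)
  let ?I = "{..<2 * k} \<rightarrow>\<^sub>E {..<n}"
  have "(\<Sum>l\<in>?I. of_bool (block_constant \<rho> l) * entry_moment M (2 * k) l j) =
      (LINT u|M. (\<Sum>l\<in>?I. of_bool (block_constant \<rho> l) * (\<Prod>s<2 * k. u $$ (l s, j s))))"
    unfolding entry_moment_def
    by (subst Bochner_Integration.integral_sum) (auto intro!: integrable_mult_right integrable_entry_prod j)
  also have "\<dots> = (LINT u|M. of_bool (block_constant \<rho> j))"
  proof (rule Bochner_Integration.integral_cong[OF refl])
    fix u assume u: "u \<in> space M"
    show "(\<Sum>l\<in>?I. of_bool (block_constant \<rho> l) * (\<Prod>s<2 * k. u $$ (l s, j s))) =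
        of_bool (block_constant \<rho> j)"
    proof (rule sum_pairing_prod[OF \<rho>])
      fix s t assume "s < 2 * k" "t < 2 * k"
      then show "(\<Sum>v<n. u $$ (v, j s) * u $$ (v, j t)) = of_bool (j s = j t)"
        using u PiE_mem[OF j, of s] PiE_mem[OF j, of t]
        by (intro orthogonal_group_cols) (auto simp: space_haar)
    qed
  qed
  finally show ?thesis by (simp add: prob_space)
qed

end

section \<open>From the exponent matrix to multi-indices: both index lists are projections of one
  list of positions\<close>

definition index_pairs :: "nat mat \<Rightarrow> (nat \<times> nat) list" where
  "index_pairs a = concat (map (\<lambda>i. concat (map (\<lambda>j. replicate (a $$ (i, j)) (i, j)) [0..<dim_col a])) [0..<dim_row a])"

lemma left_index_eq: "left_index a = map fst (index_pairs a)"
  by (simp add: left_index_def index_pairs_def map_concat comp_def)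

lemma right_index_eq: "right_index a = map snd (index_pairs a)"
  by (simp add: right_index_def index_pairs_def map_concat comp_def)

lemma length_index_pairs: "length (index_pairs a) = (\<Sum>i<dim_row a. \<Sum>j<dim_col a. a $$ (i, j))"
  by (simp add: index_pairs_def length_concat comp_def interv_sum_list_conv_sum_set_nat atLeast0LessThan)

lemma set_index_pairs: "set (index_pairs a) \<subseteq> {..<dim_row a} \<times> {..<dim_col a}"
  by (auto simp: index_pairs_def)

lemma prod_list_concat_map: "prod_list (concat (map f xs)) = (prod_list (map (\<lambda>x. prod_list (f x)) xs) :: 'a :: comm_monoid_mult)"
  by (induction xs) simp_all

lemma prod_list_upt: "prod_list (map f [0..<n]) = (\<Prod>i<n. f i :: 'a :: comm_monoid_mult)"
  by (simp flip: prod.distinct_set_conv_list add: atLeast0LessThan)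

lemma prod_list_index_pairs:
  fixes f :: "nat \<times> nat \<Rightarrow> real"
  shows "prod_list (map f (index_pairs a)) = (\<Prod>i<dim_row a. \<Prod>j<dim_col a. f (i, j) ^ (a $$ (i, j)))"
  by (simp add: index_pairs_def map_concat comp_def prod_list_concat_map prod_list_upt)

theorem theorem4p3:
  fixes p q k :: nat and a :: "nat mat"
  assumes "p > 0" and "q > 0"
    and "a \<in> carrier_mat p q"
    and "even (\<Sum>i<p. \<Sum>j<q. a $$ (i, j))"
    and "k = (\<Sum>i<p. \<Sum>j<q. a $$ (i, j)) div 2"
  shows "\<exists>N. \<forall>n\<ge>N. p \<le> n \<longrightarrow> q \<le> n \<longrightarrow>
    summable (\<lambda>d. real_of_int (signed_count k a d) / real n ^ d) \<and>
    (\<forall>M. is_orthogonal_haar n M \<longrightarrow>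
      orthogonal_integral M a =
        1 / real n ^ k * (\<Sum>d. real_of_int (signed_count k a d) / real n ^ d))"
\<comment> \<open>The bound \<open>k\<close> is for the spanning theorem, and the successor of the
  number of pairings for convergence of the path series.\<close>
proof (intro exI[of _ "max k (Suc (card (pairings k)))"] allI impI conjI)
  fix n M assume N: "max k (Suc (card (pairings k))) \<le> n" and pq: "p \<le> n" "q \<le> n"
  let ?P = "pairings k" and ?ps = "index_pairs a"
  let ?L = "{\<pi> \<in> ?P. pairing_delta \<pi> (left_index a)}"
  let ?R = "{\<sigma> \<in> ?P. pairing_delta \<sigma> (right_index a)}"
  have n: "k \<le> n" "card ?P < n" using N by auto
  note sums = signed_count_sums[OF n(2), of a]
  show "summable (\<lambda>d. real_of_int (signed_count k a d) / real n ^ d)"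
    using sums by (rule sums_summable)
  assume haar: "is_orthogonal_haar n M"
  have dim: "dim_row a = p" "dim_col a = q" using assms(3) by auto
  have len: "length ?ps = 2 * k"
    using assms(4,5) by (simp add: length_index_pairs dim)
  define i where "i = (\<lambda>s\<in>{..<2 * k}. left_index a ! s)"
  define j where "j = (\<lambda>s\<in>{..<2 * k}. right_index a ! s)"
  have mem: "?ps ! s \<in> {..<p} \<times> {..<q}" if "s < 2 * k" for s
    using set_index_pairs[of a] nth_mem[of s ?ps] that len dim by auto
  have "i s < n \<and> j s < n" if "s < 2 * k" for s
    using mem[OF that] pq that by (auto simp: i_def j_def left_index_eq right_index_eq len)
  then have ij: "i \<in> {..<2 * k} \<rightarrow>\<^sub>E {..<n}" "j \<in> {..<2 * k} \<rightarrow>\<^sub>E {..<n}"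
    by (auto simp: i_def j_def)
  have "(\<Prod>i<dim_row a. \<Prod>j<dim_col a. u $$ (i, j) ^ (a $$ (i, j))) = (\<Prod>s<2 * k. u $$ (i s, j s))"
    for u :: "real mat"
  proof -
    have "(\<Prod>i<dim_row a. \<Prod>j<dim_col a. u $$ (i, j) ^ (a $$ (i, j))) = prod_list (map (($$) u) ?ps)"
      by (rule prod_list_index_pairs[symmetric])
    also have "\<dots> = (\<Prod>s<2 * k. u $$ (?ps ! s))"
      by (simp add: prod.list_conv_set_nth len atLeast0LessThan)
    also have "\<dots> = (\<Prod>s<2 * k. u $$ (i s, j s))"
      by (intro prod.cong refl) (simp add: i_def j_def left_index_eq right_index_eq len)
    finally show ?thesis .
  qed
  then have "orthogonal_integral M a = entry_moment M (2 * k) i j"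
    by (simp add: orthogonal_integral_def entry_moment_def)
  \<comment> \<open>The left index is where the tensor is evaluated, and the right index enters only
    through the contraction values \<open>\<beta>\<close>. This yields the two different end
    conditions of an admissible path.\<close>
  also have "\<dots> = 1 / real n ^ k * (\<Sum>\<pi>\<in>?P. of_bool (block_constant \<pi> i) *
      (\<Sum>\<rho>\<in>?P. path_series k n \<pi> \<rho> * of_bool (block_constant \<rho> j)))"
    by (rule invariant_tensor_eq_path_series[OF invariant_tensor_entry_moment[OF haar ij(2)] n
          sum_pairing_entry_moment[OF haar _ ij(2)] ij(1)])
  also have "(\<Sum>\<pi>\<in>?P. of_bool (block_constant \<pi> i) *
      (\<Sum>\<rho>\<in>?P. path_series k n \<pi> \<rho> * of_bool (block_constant \<rho> j))) =
      (\<Sum>\<pi>\<in>?P. of_bool (pairing_delta \<pi> (left_index a)) *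
      (\<Sum>\<rho>\<in>?P. path_series k n \<pi> \<rho> * of_bool (pairing_delta \<rho> (right_index a))))"
    unfolding i_def j_def
    by (intro sum.cong refl arg_cong2[of _ _ _ _ "(*)"])
      (simp_all add: block_constant_iff_pairing_delta left_index_eq right_index_eq len)
  also have "\<dots> = (\<Sum>\<pi>\<in>?L. \<Sum>\<sigma>\<in>?R. path_series k n \<pi> \<sigma>)"
    by (simp only: sum.inter_filter[OF finite_pairings]) (auto intro!: sum.cong)
  also have "\<dots> = (\<Sum>d. real_of_int (signed_count k a d) / real n ^ d)"
    using sums by (rule sums_unique)
  finally show "orthogonal_integral M a =
      1 / real n ^ k * (\<Sum>d. real_of_int (signed_count k a d) / real n ^ d)" .
qed

end
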